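(* Let $n\ge1$, $v\in\mathbb{C}^*$ not a root of unity, $\mathtt m,k\in\mathbb{Z}$. The following sequences of operators ($N=1,2,\dots$) stabilize: $$\tilde\Psi_k=(-1)^Nv^{\lfloor\frac{N-1-\mathtt m-k}{n}\rfloor-N}\,\Psi_k:\Lambda^N\to\Lambda^{N+1},\qquad \tilde\Psi_k^*=(-1)^{N-1}[N]_v^-\,v^{N-1-\lfloor\frac{N-1-\mathtt m+k}{n}\rfloor}\,\Psi_k^*:\Lambda^N\to\Lambda^{N-1}.$$
   Context: $V=\mathbb{C}^n[Y^{\pm1}]$, $\mathbb{C}^n$ with basis $e_0,\dots,e_{n-1}$; $e_{nj+a}=Y^je_a$ ($j\in\mathbb{Z}$, $0\le a<n$). Identify $V^{\otimes N}=(\mathbb{C}^n)^{\otimes N}[Y_1^{\pm1},\dots,Y_N^{\pm1}]$. Hecke generators act by $T_i=s_i^YR_{i,i+1}+(v-v^{-1})\frac{s_i^Y-1}{Y_i/Y_{i+1}-1}$, where $s^Y_i$ swaps only the variables $Y_i,Y_{i+1}$ and $R=v\sum_aE_{aa}\otimes E_{aa}+\sum_{a<b}(E_{ab}\otimes E_{ba}+E_{ba}\otimes E_{ab}+(v-v^{-1})E_{aa}\otimes E_{bb})$ acts on tensor factors $i,i+1$. $[i]^{-}_v=\frac{v^{-2i}-1}{v^{-2}-1}$, $[N]!^-_v=\prod_{i=1}^N[i]_v^-$, $\mathbf{S}_-=\frac1{[N]!^-_v}\sum_{w\in S_N}(-v)^{-\ell(w)}T_w$, $\Lambda^N=\mathbf{S}_-V^{\otimes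 N}$, $e_{i_1}\wedge\dots\wedge e_{i_N}=\mathbf{S}_-(e_{i_1}\otimes\dots\otimes e_{i_N})$; those with $i_1<\dots<i_N$ form a basis of $\Lambda^N$. $\varphi^{(\mathtt m)}_{N+1,N}:\Lambda^N\to\Lambda^{N+1}$, $w\mapsto w\wedge e_{N-\mathtt m}$ (i.e. $e_{i_1}\wedge\dots\wedge e_{i_N}\mapsto e_{i_1}\wedge\dots\wedge e_{i_N}\wedge e_{N-\mathtt m}$), and $\varphi^{(\mathtt m)}_{R,N}$ ($R>N$) are the composites. $\Psi_k(w)=w\wedge e_k$. For $w=\sum y_{t_1,\dots,t_N}e_{t_1}\otimes\dots\otimes e_{t_N}\in\Lambda^N\subset V^{\otimes N}$, $\Psi^*_k(w)=\sum_{t_1,\dots,t_{N-1}}y_{t_1,\dots,t_{N-1},-k}e_{t_1}\otimes\dots\otimes e_{t_{N-1}}$, which lies in $\Lambda^{N-1}$. A sequence $A^{(N)}:\Lambda^N\to\Lambda^{N+\delta}$ *stabilizes* if for any $l$ and $w\in\Lambda^l$ there is $M$ such that for all $N>M$: $\varphi^{(\mathtt m+\delta)}_{N+n+\delta,N+\delta}\circ A^{(N)}\circ\varphi^{(\mathtt m)}_{N,l}(w)=A^{(N+n)}\circ\varphi^{(\mathtt m)}_{N+n,l}(w)$. *)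

theory Defs
  imports Complex_Main "HOL-Library.Poly_Mapping" "HOL-Library.FuncSet"
    "HOL-Combinatorics.Permutations"
begin

section \<open>Tensor powers of $V$\<close>

text \<open>
  A list \<open>[t\<^sub>1, \<dots>, t\<^sub>N]\<close> of integers stands for the basis vector
  \<open>e\<^bsub>t\<^sub>1\<^esub> \<otimes> \<dots> \<otimes> e\<^bsub>t\<^sub>N\<^esub>\<close>, where \<open>e\<^bsub>n j + a\<^esub> = Y\<^sup>j e\<^sub>a\<close>; so an entry \<open>t\<close> has
  \<open>Y\<close>-exponent \<open>t div n\<close> and \<open>\<complex>\<^sup>n\<close>-index \<open>t mod n\<close>. All \<open>V\<^bsup>\<otimes>N\<^esup>\<close> sit inside one type.
  Positions in lists, and hence the tensor factors and the Hecke generators, are counted from 0.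
\<close>

type_synonym tens = "int list \<Rightarrow>\<^sub>0 complex"

definition tensor_space :: "nat \<Rightarrow> tens set" where
  "tensor_space N = {x. \<forall>t \<in> Poly_Mapping.keys x. length t = N}"

definition e_basis :: "int list \<Rightarrow> tens" where
  "e_basis t = Poly_Mapping.single t 1"

definition scale :: "complex \<Rightarrow> tens \<Rightarrow> tens" where
  "scale c x = Poly_Mapping.map (\<lambda>y. c * y) x"

definition lin_ext :: "(int list \<Rightarrow> tens) \<Rightarrow> tens \<Rightarrow> tens" where
  "lin_ext f x = (\<Sum>t \<in> Poly_Mapping.keys x. scale (Poly_Mapping.lookup x t) (f t))"

section \<open>The action of the Hecke algebra\<close>

text \<open>\<open>s_Y n i\<close> swaps the variables at positions \<open>i\<close> and \<open>i + 1\<close>, leaving the \<open>\<complex>\<^sup>n\<close>-indices in place.\<close>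

definition s_Y :: "nat \<Rightarrow> nat \<Rightarrow> tens \<Rightarrow> tens" where
  "s_Y n i = lin_ext (\<lambda>t. e_basis
     (t[i := int n * (t ! Suc i div int n) + t ! i mod int n,
        Suc i := int n * (t ! i div int n) + t ! Suc i mod int n]))"

definition mult_Y_ratio :: "nat \<Rightarrow> nat \<Rightarrow> tens \<Rightarrow> tens" where
  "mult_Y_ratio n i = lin_ext (\<lambda>t. e_basis (t[i := t ! i + int n, Suc i := t ! Suc i - int n]))"

text \<open>
  \<open>(s\<^sub>i\<^sup>Y - 1) x / (Y\<^sub>i / Y\<^bsub>i+1\<^esub> - 1)\<close>: the division is exact and the quotient is unique
  in \<open>V\<^bsup>\<otimes>N\<^esup>\<close>.
\<close>

definition div_diff :: "nat \<Rightarrow> nat \<Rightarrow> nat \<Rightarrow> tens \<Rightarrow> tens" where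
  "div_diff n N i x =
     (THE g. g \<in> tensor_space N \<and> mult_Y_ratio n i g - g = s_Y n i x - x)"

text \<open>\<open>E_tensor n i a b c d\<close> is \<open>E\<^bsub>ab\<^esub> \<otimes> E\<^bsub>cd\<^esub>\<close> on positions \<open>i\<close>, \<open>i + 1\<close>, where \<open>E\<^bsub>ab\<^esub> e\<^sub>b = e\<^sub>a\<close>.\<close>

definition E_tensor :: "nat \<Rightarrow> nat \<Rightarrow> nat \<Rightarrow> nat \<Rightarrow> nat \<Rightarrow> nat \<Rightarrow> tens \<Rightarrow> tens" where
  "E_tensor n i a b c d = lin_ext (\<lambda>t.
     if t ! i mod int n = int b \<and> t ! Suc i mod int n = int d
     then e_basis (t[i := int n * (t ! i div int n) + int a,
                     Suc i := int n * (t ! Suc i div int n) + int c])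
     else 0)"

definition R_op :: "nat \<Rightarrow> complex \<Rightarrow> nat \<Rightarrow> tens \<Rightarrow> tens" where
  "R_op n v i x =
     scale v (\<Sum>a<n. E_tensor n i a a a a x)
     + (\<Sum>b<n. \<Sum>a<b. E_tensor n i a b b a x + E_tensor n i b a a b x
                     + scale (v - inverse v) (E_tensor n i a a b b x))"

definition T_gen :: "nat \<Rightarrow> complex \<Rightarrow> nat \<Rightarrow> nat \<Rightarrow> tens \<Rightarrow> tens" where
  "T_gen n v N i x = s_Y n i (R_op n v i x) + scale (v - inverse v) (div_diff n N i x)"

text \<open>The symmetric group \<open>S\<^sub>N\<close> acts on \<open>{..<N}\<close>; the length is the number of inversions.\<close>

definition perm_length :: "nat \<Rightarrow> (nat \<Rightarrow> nat) \<Rightarrow> nat" where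
  "perm_length N w = card {(i, j). i < j \<and> j < N \<and> w j < w i}"

definition reduced_word :: "nat \<Rightarrow> (nat \<Rightarrow> nat) \<Rightarrow> nat list \<Rightarrow> bool" where
  "reduced_word N w is \<longleftrightarrow>
     (\<forall>i \<in> set is. Suc i < N) \<and>
     w = foldr (\<lambda>i p. Transposition.transpose i (Suc i) \<circ> p) is id \<and>
     length is = perm_length N w"

text \<open>By the braid relations \<open>T\<^sub>w\<close> does not depend on the chosen reduced word.\<close>

definition T_perm :: "nat \<Rightarrow> complex \<Rightarrow> nat \<Rightarrow> (nat \<Rightarrow> nat) \<Rightarrow> tens \<Rightarrow> tens" where
  "T_perm n v N w x = foldr (T_gen n v N) (SOME is. reduced_word N w is) x"

section \<open>Wedge powers\<close>

definition qint_minus :: "complex \<Rightarrow> nat \<Rightarrow> complex" where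
  "qint_minus v i = (v powi (- 2 * int i) - 1) / (v powi (- 2) - 1)"

definition qfact_minus :: "complex \<Rightarrow> nat \<Rightarrow> complex" where
  "qfact_minus v N = (\<Prod>i = 1..N. qint_minus v i)"

definition S_minus :: "nat \<Rightarrow> complex \<Rightarrow> nat \<Rightarrow> tens \<Rightarrow> tens" where
  "S_minus n v N x = scale (1 / qfact_minus v N)
     (\<Sum>w | w permutes {..<N}. scale ((- v) powi (- int (perm_length N w))) (T_perm n v N w x))"

definition Wedge :: "nat \<Rightarrow> complex \<Rightarrow> nat \<Rightarrow> tens set" where
  "Wedge n v N = S_minus n v N ` tensor_space N"

text \<open>
  The linear map \<open>w \<mapsto> w \<and> e\<^sub>k\<close> from \<open>\<Lambda>\<^sup>N\<close> to \<open>\<Lambda>\<^bsup>N+1\<^esup>\<close> given by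
  \<open>e\<^bsub>i\<^sub>1\<^esub> \<and> \<dots> \<and> e\<^bsub>i\<^sub>N\<^esub> \<mapsto> e\<^bsub>i\<^sub>1\<^esub> \<and> \<dots> \<and> e\<^bsub>i\<^sub>N\<^esub> \<and> e\<^sub>k\<close>, that is,
  \<open>S\<^sub>- x \<mapsto> S\<^sub>- (x \<otimes> e\<^sub>k)\<close>; the result does not depend on the representative \<open>x\<close>.
\<close>

definition wedge_e :: "nat \<Rightarrow> complex \<Rightarrow> nat \<Rightarrow> int \<Rightarrow> tens \<Rightarrow> tens" where
  "wedge_e n v N k w = (THE u. \<exists>x \<in> tensor_space N.
     w = S_minus n v N x \<and> u = S_minus n v (Suc N) (lin_ext (\<lambda>t. e_basis (t @ [k])) x))"

text \<open>
  \<open>phi n v m R N\<close> is \<open>\<phi>\<^bsub>R,N\<^esub>\<^bsup>(m)\<^esup> : \<Lambda>\<^sup>N \<rightarrow> \<Lambda>\<^sup>R\<close> for \<open>R > N\<close>, which wedges with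
  \<open>e\<^bsub>N-m\<^esub>, e\<^bsub>N+1-m\<^esub>, \<dots>, e\<^bsub>R-1-m\<^esub>\<close> in this order.
\<close>

definition phi :: "nat \<Rightarrow> complex \<Rightarrow> int \<Rightarrow> nat \<Rightarrow> nat \<Rightarrow> tens \<Rightarrow> tens" where
  "phi n v m R N w = fold (\<lambda>j. wedge_e n v j (int j - m)) [N..<R] w"

definition Psi :: "nat \<Rightarrow> complex \<Rightarrow> int \<Rightarrow> nat \<Rightarrow> tens \<Rightarrow> tens" where
  "Psi n v k N w = wedge_e n v N k w"

text \<open>The coefficient of \<open>Psi_star k w\<close> at \<open>t\<close> is the coefficient of \<open>w\<close> at \<open>t @ [- k]\<close>.\<close>

definition Psi_star :: "int \<Rightarrow> tens \<Rightarrow> tens" where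
  "Psi_star k w = Poly_Mapping.map_key (\<lambda>t. t @ [- k]) w"

section \<open>Stabilizing sequences\<close>

text \<open>
  The sequence is indexed by \<open>N \<ge> 1\<close>. The first conjunct is the typing
  \<open>A\<^bsup>(N)\<^esup> : \<Lambda>\<^sup>N \<rightarrow> \<Lambda>\<^bsup>N+\<delta>\<^esup>\<close>; the shift \<open>\<delta>\<close> is meant to be at least \<open>-1\<close>, so that
  \<open>nat\<close> does not truncate. Requiring \<open>M \<ge> l\<close> makes \<open>\<phi>\<^bsub>N,l\<^esub>\<close> meaningful for all \<open>N > M\<close>.
\<close>

definition stabilizes ::
    "nat \<Rightarrow> complex \<Rightarrow> int \<Rightarrow> int \<Rightarrow> (nat \<Rightarrow> tens \<Rightarrow> tens) \<Rightarrow> bool" where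
  "stabilizes n v m \<delta> A \<longleftrightarrow>
     (\<forall>N\<ge>1. A N \<in> Wedge n v N \<rightarrow> Wedge n v (nat (int N + \<delta>))) \<and>
     (\<forall>l. \<forall>w \<in> Wedge n v l. \<exists>M\<ge>l. \<forall>N>M.
        phi n v (m + \<delta>) (nat (int (N + n) + \<delta>)) (nat (int N + \<delta>)) (A N (phi n v m N l w))
        = A (N + n) (phi n v m (N + n) l w))"

definition Psi_tilde :: "nat \<Rightarrow> complex \<Rightarrow> int \<Rightarrow> int \<Rightarrow> nat \<Rightarrow> tens \<Rightarrow> tens" where
  "Psi_tilde n v m k N w =
     scale ((- 1) ^ N * v powi (\<lfloor>real_of_int (int N - 1 - m - k) / real n\<rfloor> - int N))
       (Psi n v k N w)"

text \<open>Only used for \<open>N \<ge> 1\<close>.\<close>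

definition Psi_star_tilde :: "nat \<Rightarrow> complex \<Rightarrow> int \<Rightarrow> int \<Rightarrow> nat \<Rightarrow> tens \<Rightarrow> tens" where
  "Psi_star_tilde n v m k N w =
     scale ((- 1) ^ (N - 1) * qint_minus v N
            * v powi (int N - 1 - \<lfloor>real_of_int (int N - 1 - m + k) / real n\<rfloor>))
       (Psi_star k w)"

end

theory Submission
  imports Defs
begin

text \<open>
  In \<open>\<Lambda>\<^sup>N\<close> one has \<open>e\<^sub>k \<and> e\<^sub>r = - c e\<^sub>r \<and> e\<^sub>k + \<dots>\<close> for \<open>k < r\<close>, with \<open>c = 1\<close> if \<open>n\<close> divides
  \<open>r - k\<close> and \<open>c = v\<^bsup>-1\<^esup>\<close> otherwise; the omitted terms only involve indices strictly between
  \<open>k\<close> and \<open>r\<close>, and the sum of the two indices is preserved. Hence \<open>e\<^sub>s \<and> \<dots> \<and> e\<^sub>t \<and> e\<^sub>r = 0\<close> for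
  \<open>s \<le> r \<le> t\<close>, and behind a long enough run \<open>e\<^sub>s \<and> \<dots> \<and> e\<^sub>t\<close> the omitted terms vanish. Moving \<open>e\<^sub>k\<close>
  past \<open>n\<close> consecutive vectors therefore multiplies by \<open>(-1)\<^sup>n v\<^bsup>1-n\<^esup>\<close>, which is the change of
  normalization of \<open>\<Psi>\<^sub>k\<close> from \<open>N\<close> to \<open>N + n\<close>.

  For \<open>\<Psi>\<^sub>k\<^sup>*\<close>, summing the antisymmetrizer over coset representatives of \<open>S\<^sub>N\<close> in \<open>S\<^bsub>N+1\<^esub>\<close> expresses
  the slice of \<open>w \<and> e\<^sub>r\<close> at last index \<open>p < r\<close> by the slice of \<open>w\<close> at \<open>p\<close> wedged with \<open>e\<^sub>r\<close>, plus slices of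
  \<open>w\<close> at indices \<open>q < p\<close> wedged with \<open>e\<^bsub>q+r-p\<^esub>\<close>. A given \<open>w\<close> has only finitely many nonzero
  slices, so by induction on \<open>p\<close> the latter terms vanish after enough wedgings.

  That the antisymmetrizer has the expected properties rests on the Hecke relations for the \<open>T\<^sub>i\<close>.
  The defect \<open>Q\<close> of the braid relation satisfies \<open>Q Y\<^sub>j = Y\<^bsub>\<sigma>(j)\<^esub> Q\<close>, which reduces this relation to
  \<open>Y\<close>-degree 0, where \<open>T\<^sub>i\<close> is the constant matrix \<open>R\<close>.
\<close>

section \<open>Linear algebra of tensors\<close>

lemma lookup_scale [simp]: "Poly_Mapping.lookup (scale c x) t = c * Poly_Mapping.lookup x t"
  by (simp add: scale_def Poly_Mapping.map.rep_eq when_def)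

lemma keys_scale: "Poly_Mapping.keys (scale c x) \<subseteq> Poly_Mapping.keys x"
  by (auto simp: in_keys_iff)

interpretation tens: vector_space scale
  by unfold_locales (auto intro!: poly_mapping_eqI simp: lookup_add algebra_simps)

interpretation tens2: vector_space_pair scale scale ..

abbreviation tlin :: "(tens \<Rightarrow> tens) \<Rightarrow> bool" where
  "tlin \<equiv> Vector_Spaces.linear scale scale"

lemma tlinI:
  assumes "\<And>x y. f (x + y) = f x + f y" "\<And>c x. f (scale c x) = scale c (f x)"
  shows "tlin f"
  using assms by unfold_locales

lemmas tlin_simps = tens2.linear_add tens2.linear_diff tens2.linear_scale tens2.linear_0
  tens2.linear_neg

lemma tlin_compose: "tlin f \<Longrightarrow> tlin g \<Longrightarrow> tlin (\<lambda>x. f (g x))"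
  by (rule tlinI) (simp_all add: tlin_simps)

lemma tlin_sum_fun: "(\<And>i. i \<in> I \<Longrightarrow> tlin (f i)) \<Longrightarrow> tlin (\<lambda>x. \<Sum>i\<in>I. f i x)"
  by (rule tlinI) (simp_all add: tlin_simps sum.distrib tens.scale_sum_right)

lemma tlin_scale_fun: "tlin f \<Longrightarrow> tlin (\<lambda>x. scale c (f x))"
  by (rule tens2.linear_compose_scale_right)

lemma tlin_add_fun: "tlin f \<Longrightarrow> tlin g \<Longrightarrow> tlin (\<lambda>x. f x + g x)"
  by (rule tens2.linear_compose_add)

lemma tlin_diff_fun: "tlin f \<Longrightarrow> tlin g \<Longrightarrow> tlin (\<lambda>x. f x - g x)"
  by (rule tens2.linear_compose_sub)

lemma tlin_ident: "tlin (\<lambda>x. x)"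
  by (rule tlinI) simp_all

lemmas tlin_intros = tlin_sum_fun tlin_scale_fun tlin_add_fun tlin_diff_fun tlin_ident

lemma lookup_lin_ext_superset:
  assumes "finite A" "Poly_Mapping.keys x \<subseteq> A"
  shows "lin_ext f x = (\<Sum>t\<in>A. scale (Poly_Mapping.lookup x t) (f t))"
  unfolding lin_ext_def
  by (rule sum.mono_neutral_left) (use assms in \<open>auto simp: in_keys_iff\<close>)

lemma tlin_lin_ext: "tlin (lin_ext f)"
proof (rule tlinI)
  fix x y :: tens
  let ?A = "Poly_Mapping.keys x \<union> Poly_Mapping.keys y"
  have "Poly_Mapping.keys (x + y) \<subseteq> ?A" by (rule keys_add)
  then show "lin_ext f (x + y) = lin_ext f x + lin_ext f y"
    by (simp add: lookup_lin_ext_superset[of ?A] lookup_add tens.scale_left_distrib sum.distrib)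
next
  fix c :: complex and x :: tens
  show "lin_ext f (scale c x) = scale c (lin_ext f x)"
    using keys_scale[of c x]
    by (simp add: lookup_lin_ext_superset[of "Poly_Mapping.keys x"] tens.scale_sum_right)
qed

lemma lin_ext_0 [simp]: "lin_ext f 0 = 0"
  by (simp add: lin_ext_def)

lemma lin_ext_e_basis [simp]: "lin_ext f (e_basis t) = f t"
  by (simp add: lin_ext_def e_basis_def)

lemma lookup_e_basis: "Poly_Mapping.lookup (e_basis t) u = (if t = u then 1 else 0)"
  by (simp add: e_basis_def lookup_single when_def)

lemma tens_expansion: "x = (\<Sum>t\<in>Poly_Mapping.keys x. scale (Poly_Mapping.lookup x t) (e_basis t))"
  by (rule poly_mapping_eqI)
     (auto simp: lookup_sum lookup_e_basis if_distrib in_keys_iff cong: if_cong)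

lemma subspace_tensor_space: "tens.subspace (tensor_space N)"
proof (rule tens.subspaceI)
  fix x y assume "x \<in> tensor_space N" "y \<in> tensor_space N"
  then show "x + y \<in> tensor_space N"
    using keys_add[of x y] by (auto simp: tensor_space_def)
qed (use keys_scale in \<open>auto simp: tensor_space_def\<close>)

lemmas ts_0 [simp] = tens.subspace_0[OF subspace_tensor_space]
lemmas ts_add [simp] = tens.subspace_add[OF subspace_tensor_space]
lemmas ts_diff [simp] = tens.subspace_diff[OF subspace_tensor_space]
lemmas ts_neg [simp] = tens.subspace_neg[OF subspace_tensor_space]
lemmas ts_scale [simp] = tens.subspace_scale[OF subspace_tensor_space]
lemmas ts_sum = tens.subspace_sum[OF subspace_tensor_space]

lemma e_basis_in_ts [simp]: "e_basis t \<in> tensor_space N \<longleftrightarrow> length t = N"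
  by (simp add: tensor_space_def e_basis_def)

lemma lin_ext_in_subspace:
  assumes "tens.subspace S" "x \<in> tensor_space N" "\<And>t. length t = N \<Longrightarrow> f t \<in> S"
  shows "lin_ext f x \<in> S"
  unfolding lin_ext_def
  by (rule tens.subspace_sum[OF assms(1)])
     (use assms in \<open>auto simp: tensor_space_def intro!: tens.subspace_scale\<close>)

lemmas lin_ext_in_ts = lin_ext_in_subspace[OF subspace_tensor_space]

lemma tlin_eqI:
  assumes "tlin f" "tlin g" "x \<in> tensor_space N"
    and "\<And>t. length t = N \<Longrightarrow> f (e_basis t) = g (e_basis t)"
  shows "f x = g x"
proof -
  have "f x = (\<Sum>t\<in>Poly_Mapping.keys x. scale (Poly_Mapping.lookup x t) (f (e_basis t)))"
    by (subst tens_expansion[of x])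
       (simp add: tens2.linear_sum[OF assms(1)] tlin_simps[OF assms(1)])
  also have "\<dots> = (\<Sum>t\<in>Poly_Mapping.keys x. scale (Poly_Mapping.lookup x t) (g (e_basis t)))"
    by (rule sum.cong) (use assms(3,4) in \<open>auto simp: tensor_space_def\<close>)
  also have "\<dots> = g x"
    by (subst (3) tens_expansion[of x])
       (simp add: tens2.linear_sum[OF assms(2)] tlin_simps[OF assms(2)])
  finally show ?thesis .
qed

section \<open>The operators in the Hecke action\<close>

text \<open>Multiplication by the variable Y_j: adding n to an entry raises its exponent by one and
  keeps its residue.\<close>

definition Y_op :: "nat \<Rightarrow> nat \<Rightarrow> tens \<Rightarrow> tens" where
  "Y_op n j = lin_ext (\<lambda>t. e_basis (t[j := t ! j + int n]))"

text \<open>The vector u^s e_t for u = Y_i / Y_(i+1).\<close>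

definition div_diff_term :: "nat \<Rightarrow> nat \<Rightarrow> int list \<Rightarrow> int \<Rightarrow> tens" where
  "div_diff_term n i t s = e_basis (t[i := t ! i + int n * s, Suc i := t ! Suc i - int n * s])"

text \<open>The quotient \<open>(u\<^sup>d - 1) / (u - 1)\<close> with \<open>u = Y\<^sub>i / Y\<^bsub>i+1\<^esub>\<close> as an explicit sum; only the first
  sum is nonempty for \<open>d > 0\<close>, and only the second for \<open>d < 0\<close>.\<close>

definition div_diff_op :: "nat \<Rightarrow> nat \<Rightarrow> tens \<Rightarrow> tens" where
  "div_diff_op n i = lin_ext (\<lambda>t. let d = t ! Suc i div int n - t ! i div int n in
     (\<Sum>s\<in>{0..<d}. div_diff_term n i t s) - (\<Sum>s\<in>{d..<0}. div_diff_term n i t s))"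

text \<open>\<open>T_gen\<close> with the definite description replaced by an explicit quotient. It
  is linear on all tensors and does not mention N, so the same operator serves every tensor
  power.\<close>

definition T_op :: "nat \<Rightarrow> complex \<Rightarrow> nat \<Rightarrow> tens \<Rightarrow> tens" where
  "T_op n v i x = s_Y n i (R_op n v i x) + scale (v - inverse v) (div_diff_op n i x)"

lemma tlin_s_Y: "tlin (s_Y n i)"
  and tlin_Y_op: "tlin (Y_op n i)"
  and tlin_mult_Y_ratio: "tlin (mult_Y_ratio n i)"
  and tlin_div_diff_op: "tlin (div_diff_op n i)"
  and tlin_E_tensor: "tlin (E_tensor n i a b c d)"
  unfolding s_Y_def Y_op_def mult_Y_ratio_def div_diff_op_def E_tensor_def
  by (rule tlin_lin_ext)+

lemma tlin_R_op: "tlin (R_op n v i)"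
  unfolding R_op_def by (intro tlin_intros tlin_E_tensor)

lemma tlin_T_op: "tlin (T_op n v i)"
  unfolding T_op_def by (intro tlin_intros tlin_compose[OF tlin_s_Y] tlin_R_op tlin_div_diff_op)

lemmas op_lin = tlin_simps[OF tlin_s_Y] tlin_simps[OF tlin_Y_op] tlin_simps[OF tlin_mult_Y_ratio]
  tlin_simps[OF tlin_div_diff_op] tlin_simps[OF tlin_R_op]
lemmas T_op_lin = tlin_simps[OF tlin_T_op]

lemma s_Y_in_ts [simp]: "x \<in> tensor_space N \<Longrightarrow> s_Y n i x \<in> tensor_space N"
  and Y_op_in_ts [simp]: "x \<in> tensor_space N \<Longrightarrow> Y_op n i x \<in> tensor_space N"
  and mult_Y_ratio_in_ts [simp]: "x \<in> tensor_space N \<Longrightarrow> mult_Y_ratio n i x \<in> tensor_space N"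
  and div_diff_op_in_ts [simp]: "x \<in> tensor_space N \<Longrightarrow> div_diff_op n i x \<in> tensor_space N"
  and E_tensor_in_ts [simp]: "x \<in> tensor_space N \<Longrightarrow> E_tensor n i a b c d x \<in> tensor_space N"
  unfolding s_Y_def Y_op_def mult_Y_ratio_def div_diff_op_def E_tensor_def
  by (erule lin_ext_in_ts, auto simp: Let_def div_diff_term_def intro!: ts_diff ts_sum)+

lemma R_op_in_ts [simp]: "x \<in> tensor_space N \<Longrightarrow> R_op n v i x \<in> tensor_space N"
  unfolding R_op_def by (intro ts_add ts_scale ts_sum E_tensor_in_ts)

lemma T_op_in_ts [simp]: "x \<in> tensor_space N \<Longrightarrow> T_op n v i x \<in> tensor_space N"
  unfolding T_op_def by simp

lemma s_Y_basis: "s_Y n i (e_basis t) = e_basis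
     (t[i := int n * (t ! Suc i div int n) + t ! i mod int n,
        Suc i := int n * (t ! i div int n) + t ! Suc i mod int n])"
  by (simp add: s_Y_def)

lemma Y_op_basis: "Y_op n j (e_basis t) = e_basis (t[j := t ! j + int n])"
  by (simp add: Y_op_def)

lemma mult_Y_ratio_basis:
  "mult_Y_ratio n i (e_basis t) = e_basis (t[i := t ! i + int n, Suc i := t ! Suc i - int n])"
  by (simp add: mult_Y_ratio_def)

lemma div_diff_op_basis:
  "div_diff_op n i (e_basis t) = (let d = t ! Suc i div int n - t ! i div int n in
     (\<Sum>s\<in>{0..<d}. div_diff_term n i t s) - (\<Sum>s\<in>{d..<0}. div_diff_term n i t s))"
  by (simp add: div_diff_op_def)

lemma sum_delta_pair_less:
  fixes f :: "nat \<Rightarrow> nat \<Rightarrow> 'a::comm_monoid_add"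
  shows "(\<Sum>b<n. \<Sum>a<b. if a = a0 \<and> b = b0 then f a b else 0) = (if a0 < b0 \<and> b0 < n then f a0 b0 else 0)"
proof -
  have "(\<Sum>a<b. if a = a0 \<and> b = b0 then f a b else 0) = (if b = b0 then if a0 < b0 then f a0 b0 else 0 else 0)" for b
    by (cases "b = b0") (simp_all add: sum.delta)
  then show ?thesis by simp
qed

text \<open>Exactly one pair of matrix indices matches the residues of the two entries, so each sum
  in R has at most one nonzero term.\<close>

lemma R_op_basis:
  assumes "n \<ge> 1"
  shows "R_op n v i (e_basis t) =
    (let a = t ! i mod int n; b = t ! Suc i mod int n;
         t' = t[i := int n * (t ! i div int n) + b, Suc i := int n * (t ! Suc i div int n) + a]
     in if a = b then scale v (e_basis t) else if a < b then e_basis t' + scale (v - inverse v) (e_basis t)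
        else e_basis t')"
proof -
  define a0 where "a0 = nat (t ! i mod int n)"
  define b0 where "b0 = nat (t ! Suc i mod int n)"
  have ab: "t ! i mod int n = int a0" "t ! Suc i mod int n = int b0" "a0 < n" "b0 < n"
    using assms(1) by (auto simp: a0_def b0_def nat_less_iff)
  define e where "e = (\<lambda>c d. e_basis (t[i := int n * (t ! i div int n) + int c,
                     Suc i := int n * (t ! Suc i div int n) + int d]))"
  have E: "E_tensor n i a b c d (e_basis t) = (if b = a0 \<and> d = b0 then e a c else 0)" for a b c d
    by (auto simp: E_tensor_def e_def ab)
  have e0: "e a0 b0 = e_basis t"
    unfolding e_def ab(1,2)[symmetric] by simp
  have 1: "(\<Sum>a<n. E_tensor n i a a a a (e_basis t)) = (if a0 = b0 then e_basis t else 0)"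
  proof (cases "a0 = b0")
    case True
    then have "(\<Sum>a<n. E_tensor n i a a a a (e_basis t)) = (\<Sum>a<n. if a = a0 then e a0 a0 else 0)"
      by (intro sum.cong) (auto simp: E)
    then show ?thesis using ab e0 True by simp
  next
    case False
    then have "(\<Sum>a<n. E_tensor n i a a a a (e_basis t)) = (\<Sum>a<n. 0)"
      by (intro sum.cong) (auto simp: E)
    then show ?thesis using False by simp
  qed
  have 2: "(\<Sum>b<n. \<Sum>a<b. E_tensor n i a b b a (e_basis t)) = (if b0 < a0 then e b0 a0 else 0)"
  proof -
    have "(\<Sum>b<n. \<Sum>a<b. E_tensor n i a b b a (e_basis t)) =
       (\<Sum>b<n. \<Sum>a<b. if a = b0 \<and> b = a0 then e a b else 0)"
      by (intro sum.cong) (auto simp: E)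
    then show ?thesis using ab by (simp add: sum_delta_pair_less)
  qed
  have 3: "(\<Sum>b<n. \<Sum>a<b. E_tensor n i b a a b (e_basis t)) = (if a0 < b0 then e b0 a0 else 0)"
  proof -
    have "(\<Sum>b<n. \<Sum>a<b. E_tensor n i b a a b (e_basis t)) =
       (\<Sum>b<n. \<Sum>a<b. if a = a0 \<and> b = b0 then e b a else 0)"
      by (intro sum.cong) (auto simp: E)
    then show ?thesis using ab by (simp add: sum_delta_pair_less)
  qed
  have 4: "(\<Sum>b<n. \<Sum>a<b. scale (v - inverse v) (E_tensor n i a a b b (e_basis t))) =
      (if a0 < b0 then scale (v - inverse v) (e_basis t) else 0)"
  proof -
    have "(\<Sum>b<n. \<Sum>a<b. scale (v - inverse v) (E_tensor n i a a b b (e_basis t))) =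
       (\<Sum>b<n. \<Sum>a<b. if a = a0 \<and> b = b0 then scale (v - inverse v) (e a b) else 0)"
      by (intro sum.cong) (auto simp: E)
    then show ?thesis using ab by (simp add: sum_delta_pair_less e0)
  qed
  show ?thesis
    unfolding R_op_def sum.distrib 1 2 3 4 ab(1,2) Let_def e_def by (auto simp: of_nat_less_iff)
qed

text \<open>Take a key of g with the largest entry at position i. Its shift is hit by no other key,
  hence would again be a key of g, with a larger entry. This is what makes the division by u - 1
  unique.\<close>

lemma mult_Y_ratio_fixed:
  assumes "n \<ge> 1" "Suc i < N" "g \<in> tensor_space N" "mult_Y_ratio n i g = g"
  shows "g = 0"
proof (rule ccontr)
  assume "g \<noteq> 0"
  then have ne: "Poly_Mapping.keys g \<noteq> {}" by simp
  define f where "f = (\<lambda>t :: int list. t[i := t ! i + int n, Suc i := t ! Suc i - int n])"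
  let ?I = "(\<lambda>t. t ! i) ` Poly_Mapping.keys g"
  have "Max ?I \<in> ?I" using ne by (intro Max_in) auto
  then obtain t where t: "t \<in> Poly_Mapping.keys g" "t ! i = Max ?I"
    by force
  then have max: "u ! i \<le> t ! i" if "u \<in> Poly_Mapping.keys g" for u
    using that by simp
  have len: "length u = N" if "u \<in> Poly_Mapping.keys g" for u
    using assms(3) that by (auto simp: tensor_space_def)
  have inj: "f u = f t \<longleftrightarrow> u = t" if "u \<in> Poly_Mapping.keys g" for u
  proof
    assume eq: "f u = f t"
    have "u ! j = t ! j" if "j < N" for j
      using arg_cong[OF eq, of "\<lambda>l. l ! j"] len[OF \<open>u \<in> _\<close>] len[OF t(1)] that assms(2)
      by (auto simp: f_def nth_list_update split: if_splits)
    then show "u = t" using len[OF \<open>u \<in> _\<close>] len[OF t(1)] by (auto intro: nth_equalityI)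
  qed simp
  have "Poly_Mapping.lookup (mult_Y_ratio n i g) (f t) = (\<Sum>u\<in>Poly_Mapping.keys g. if u = t then Poly_Mapping.lookup g u else 0)"
    unfolding mult_Y_ratio_def lin_ext_def lookup_sum
  proof (rule sum.cong)
    fix u assume "u \<in> Poly_Mapping.keys g"
    from inj[OF this] show "Poly_Mapping.lookup (scale (Poly_Mapping.lookup g u)
        (e_basis (u[i := u ! i + int n, Suc i := u ! Suc i - int n]))) (f t) =
      (if u = t then Poly_Mapping.lookup g u else 0)"
      by (simp add: lookup_e_basis f_def)
  qed simp
  also have "\<dots> = Poly_Mapping.lookup g t" using t(1) by simp
  finally have "f t \<in> Poly_Mapping.keys g" using t(1) assms(4) by (simp add: in_keys_iff)
  from max[OF this] len[OF t(1)] assms(1,2) show False by (simp add: f_def)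
qed

lemma mult_Y_ratio_inject:
  assumes "n \<ge> 1" "Suc i < N" "g \<in> tensor_space N" "h \<in> tensor_space N"
    and "mult_Y_ratio n i g - g = mult_Y_ratio n i h - h"
  shows "g = h"
proof -
  have "mult_Y_ratio n i (g - h) = g - h" using assms(5) by (simp add: op_lin algebra_simps)
  then show ?thesis using mult_Y_ratio_fixed[of n i N "g - h"] assms by simp
qed

lemma sum_telescope_int:
  fixes f :: "int \<Rightarrow> 'a::ab_group_add"
  assumes "a \<le> b"
  shows "(\<Sum>s\<in>{a..<b}. f (s + 1) - f s) = f b - f a"
  using assms
proof (induction b rule: int_ge_induct)
  case (step b)
  then have "{a..<b + 1} = insert b {a..<b}" by auto
  with step show ?case by simp
qed simp

lemma list_update_pair_overwrite: "xs[i := a, Suc i := b, i := c, Suc i := d] = xs[i := c, Suc i := d]"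
  by (subst list_update_swap[of "Suc i" i]) simp_all

lemma div_diff_op_eq:
  assumes "n \<ge> 1" "Suc i < N" "x \<in> tensor_space N"
  shows "mult_Y_ratio n i (div_diff_op n i x) - div_diff_op n i x = s_Y n i x - x"
proof (rule tlin_eqI[OF _ _ assms(3)])
  fix t :: "int list" assume len: "length t = N"
  let ?f = "div_diff_term n i t"
  define d where "d = t ! Suc i div int n - t ! i div int n"
  \<comment> \<open>Multiplication by u shifts the summation index, so (u - 1) times the explicit
    sum telescopes to u^d e_t - e_t.\<close>
  have u: "mult_Y_ratio n i (?f s) = ?f (s + 1)" for s
    using len assms(2)
    by (simp add: div_diff_term_def mult_Y_ratio_basis list_update_pair_overwrite distrib_left diff_diff_eq
        add.assoc)
  have f0: "?f 0 = e_basis t" by (simp add: div_diff_term_def)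
  \<comment> \<open>Since d is the difference of the two exponents, u^d interchanges them, which is
    the effect of \<open>s_Y\<close>.\<close>
  have "t ! i + int n * d = int n * (t ! Suc i div int n) + t ! i mod int n"
    "t ! Suc i - int n * d = int n * (t ! i div int n) + t ! Suc i mod int n"
    using mult_div_mod_eq[of "int n" "t ! i"] mult_div_mod_eq[of "int n" "t ! Suc i"]
    unfolding d_def right_diff_distrib by linarith+
  then have fd: "?f d = s_Y n i (e_basis t)"
    by (simp add: div_diff_term_def s_Y_basis)
  have "mult_Y_ratio n i (div_diff_op n i (e_basis t)) - div_diff_op n i (e_basis t)
     = (\<Sum>s\<in>{0..<d}. ?f (s + 1) - ?f s) - (\<Sum>s\<in>{d..<0}. ?f (s + 1) - ?f s)"
    unfolding div_diff_op_basis Let_def d_def[symmetric] tlin_simps[OF tlin_mult_Y_ratio]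
      tens2.linear_sum[OF tlin_mult_Y_ratio] u sum_subtractf by simp
  also have "\<dots> = ?f d - ?f 0"
    by (cases "d \<ge> 0") (simp_all add: sum_telescope_int)
  finally show "mult_Y_ratio n i (div_diff_op n i (e_basis t)) - div_diff_op n i (e_basis t)
     = s_Y n i (e_basis t) - e_basis t" by (simp add: f0 fd)
qed (rule tlin_diff_fun tlin_compose[OF tlin_mult_Y_ratio] tlin_div_diff_op tlin_s_Y tlin_ident)+

lemma div_diff_eq_op:
  assumes "n \<ge> 1" "Suc i < N" "x \<in> tensor_space N"
  shows "div_diff n N i x = div_diff_op n i x"
  unfolding div_diff_def
proof (rule the_equality)
  show "div_diff_op n i x \<in> tensor_space N \<and>
      mult_Y_ratio n i (div_diff_op n i x) - div_diff_op n i x = s_Y n i x - x"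
    using assms(3) div_diff_op_eq[OF assms] by simp
  fix g assume g: "g \<in> tensor_space N \<and> mult_Y_ratio n i g - g = s_Y n i x - x"
  show "g = div_diff_op n i x"
  proof (rule mult_Y_ratio_inject[OF assms(1,2)])
    show "mult_Y_ratio n i g - g = mult_Y_ratio n i (div_diff_op n i x) - div_diff_op n i x"
      using g by (simp only: div_diff_op_eq[OF assms])
  qed (use g assms(3) in simp_all)
qed

lemma T_gen_eq_T_op:
  assumes "n \<ge> 1" "Suc i < N" "x \<in> tensor_space N"
  shows "T_gen n v N i x = T_op n v i x"
  by (simp add: T_gen_def T_op_def div_diff_eq_op[OF assms])

section \<open>Coordinates at two adjacent positions and a vanishing criterion in Y-degree 0\<close>

definition upd2 :: "nat \<Rightarrow> int \<Rightarrow> int \<Rightarrow> int list \<Rightarrow> int list" where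
  "upd2 i p q t = t[i := p, Suc i := q]"

lemma length_upd2 [simp]: "length (upd2 i p q t) = length t"
  by (simp add: upd2_def)

lemma upd2_nth [simp]:
  "Suc i < length t \<Longrightarrow> upd2 i p q t ! i = p"
  "Suc i < length t \<Longrightarrow> upd2 i p q t ! Suc i = q"
  "j \<noteq> i \<Longrightarrow> j \<noteq> Suc i \<Longrightarrow> upd2 i p q t ! j = t ! j"
  by (simp_all add: upd2_def)

lemma upd2_update [simp]:
  "(upd2 i p q t)[i := r] = upd2 i r q t"
  "(upd2 i p q t)[Suc i := r] = upd2 i p r t"
  "upd2 i p q (upd2 i p' q' t) = upd2 i p q t"
  by (simp_all add: upd2_def list_update_swap[of i "Suc i"])

lemma upd2_self: "upd2 i (t ! i) (t ! Suc i) t = t"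
  by (simp add: upd2_def)

lemma upd2_update_other: "j \<noteq> i \<Longrightarrow> j \<noteq> Suc i \<Longrightarrow> (upd2 i p q t)[j := r] = upd2 i p q (t[j := r])"
  by (simp add: upd2_def list_update_swap)

abbreviation e_upd2 :: "nat \<Rightarrow> int list \<Rightarrow> int \<Rightarrow> int \<Rightarrow> tens" where
  "e_upd2 i t p q \<equiv> e_basis (upd2 i p q t)"

lemma tlin_eq_upd2:
  assumes "tlin f" "tlin g" "x \<in> tensor_space N"
    and "\<And>t p q. length t = N \<Longrightarrow> f (e_upd2 i t p q) = g (e_upd2 i t p q)"
  shows "f x = g x"
  using assms(1-3) by (rule tlin_eqI) (metis assms(4) upd2_self)

lemma Y_op_inject:
  assumes "j < N" "x \<in> tensor_space N" "Y_op n j x = 0"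
  shows "x = 0"
proof -
  let ?Y' = "lin_ext (\<lambda>t. e_basis (t[j := t ! j - int n]))"
  have "?Y' (Y_op n j x) = x"
    by (rule tlin_eqI[OF _ _ assms(2)])
       (use assms(1) in \<open>auto simp: Y_op_basis intro: tlin_ident tlin_compose[OF tlin_lin_ext tlin_Y_op]\<close>)
  then show ?thesis using assms(3) by simp
qed

text \<open>Multiplication by a variable is injective, so Q kills a basis vector iff it kills the
  one with an entry in J shifted by a multiple of n. All entries at positions in J can therefore be
  reduced modulo n.\<close>

lemma zero_if_Y_equivariant:
  assumes n: "n \<ge> 1" and Q: "tlin Q" "\<And>x. x \<in> tensor_space N \<Longrightarrow> Q x \<in> tensor_space N"
    and J: "finite J" "\<And>j. j \<in> J \<Longrightarrow> j < N \<and> \<sigma> j < N"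
    and eqv: "\<And>j x. j \<in> J \<Longrightarrow> x \<in> tensor_space N \<Longrightarrow> Q (Y_op n j x) = Y_op n (\<sigma> j) (Q x)"
    and base: "\<And>t. length t = N \<Longrightarrow> \<forall>j\<in>J. 0 \<le> t ! j \<and> t ! j < int n \<Longrightarrow> Q (e_basis t) = 0"
    and x: "x \<in> tensor_space N"
  shows "Q x = 0"
proof -
  have shift: "Q (e_basis (t[j := a + int n * k])) = 0 \<longleftrightarrow> Q (e_basis (t[j := a])) = 0"
    if t: "length t = N" and j: "j \<in> J" for t j a k
  proof -
    have *: "Q (e_basis (t[j := b + int n])) = 0 \<longleftrightarrow> Q (e_basis (t[j := b])) = 0" for b
    proof -
      have "Q (e_basis (t[j := b + int n])) = Y_op n (\<sigma> j) (Q (e_basis (t[j := b])))"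
        using eqv[OF j, of "e_basis (t[j := b])"] t J(2)[OF j] by (simp add: Y_op_basis)
      then show ?thesis
        using Y_op_inject[of "\<sigma> j" N "Q (e_basis (t[j := b]))" n] t J(2)[OF j] Q(2) by (auto simp: op_lin)
    qed
    show ?thesis
    proof (induction k rule: int_induct[where k = 0])
      case (step1 k)
      then show ?case using *[of "a + int n * k"] by (simp add: algebra_simps)
    next
      case (step2 k)
      then show ?case using *[of "a + int n * (k - 1)"] by (simp add: algebra_simps)
    qed simp
  qed
  \<comment> \<open>\<open>J'\<close> collects the positions whose entries may still be out of
    range; each induction step reduces one of them modulo n.\<close>
  have "Q (e_basis t) = 0" if "finite J'" "J' \<subseteq> J" "length t = N"
    "\<forall>j\<in>J - J'. 0 \<le> t ! j \<and> t ! j < int n" for J' t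
    using that
  proof (induction J' arbitrary: t rule: finite_induct)
    case empty
    then show ?case using base by simp
  next
    case (insert j J')
    have "j < length t" using insert.prems J(2) by blast
    then have "Q (e_basis (t[j := t ! j mod int n])) = 0"
      using insert.prems n by (intro insert.IH) (auto simp: nth_list_update)
    then have "Q (e_basis (t[j := t ! j mod int n + int n * (t ! j div int n)])) = 0"
      using shift[of t j "t ! j mod int n" "t ! j div int n"] insert.prems by simp
    then show ?case by simp
  qed
  from this[OF J(1) subset_refl] have "Q x = (\<lambda>x. 0) x"
    by (intro tlin_eqI[OF Q(1) _ x]) (auto intro: tlinI)
  then show ?thesis by simp
qed

section \<open>Relations between the variables, their exchange, R and the divided difference\<close>

context
  fixes n :: nat and N i :: nat and t :: "int list"
  assumes n: "n \<ge> 1" and i: "Suc i < N" and t: "length t = N"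
begin

lemma s_Y_upd2: "s_Y n i (e_upd2 i t p q) =
    e_upd2 i t (int n * (q div int n) + p mod int n) (int n * (p div int n) + q mod int n)"
  using i t by (simp add: s_Y_basis)

lemma Y_op_upd2:
  "Y_op n i (e_upd2 i t p q) = e_upd2 i t (p + int n) q"
  "Y_op n (Suc i) (e_upd2 i t p q) = e_upd2 i t p (q + int n)"
  "j \<noteq> i \<Longrightarrow> j \<noteq> Suc i \<Longrightarrow> Y_op n j (e_upd2 i t p q) = e_upd2 i (t[j := t ! j + int n]) p q"
  using i t by (simp_all add: Y_op_basis upd2_update_other)

lemma mult_Y_ratio_upd2: "mult_Y_ratio n i (e_upd2 i t p q) = e_upd2 i t (p + int n) (q - int n)"
  using i t by (simp add: mult_Y_ratio_basis)

lemma R_op_upd2: "R_op n v i (e_upd2 i t p q) =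
    (let p' = int n * (p div int n) + q mod int n; q' = int n * (q div int n) + p mod int n
     in if p mod int n = q mod int n then scale v (e_upd2 i t p q)
        else if p mod int n < q mod int n then e_upd2 i t p' q' + scale (v - inverse v) (e_upd2 i t p q)
        else e_upd2 i t p' q')"
  using i t by (simp add: R_op_basis[OF n] upd2_def[symmetric] Let_def)

end

lemmas op_upd2 = s_Y_upd2 Y_op_upd2 mult_Y_ratio_upd2

lemmas tlin_op_intros = tlin_diff_fun tlin_add_fun tlin_scale_fun tlin_ident
  tlin_s_Y tlin_Y_op tlin_mult_Y_ratio tlin_div_diff_op tlin_R_op tlin_T_op
  tlin_compose[OF tlin_s_Y] tlin_compose[OF tlin_Y_op] tlin_compose[OF tlin_mult_Y_ratio]
  tlin_compose[OF tlin_div_diff_op] tlin_compose[OF tlin_R_op] tlin_compose[OF tlin_T_op]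

context
  fixes n :: nat and N i :: nat and x :: tens
  assumes n: "n \<ge> 1" and i: "Suc i < N" and x: "x \<in> tensor_space N"
begin

lemma s_Y_Y_op:
  "s_Y n i (Y_op n i x) = Y_op n (Suc i) (s_Y n i x)"
  "s_Y n i (Y_op n (Suc i) x) = Y_op n i (s_Y n i x)"
  by (rule tlin_eq_upd2[OF _ _ x, of _ _ i], (rule tlin_op_intros)+,
      use n i in \<open>simp add: op_upd2[OF n i] distrib_left add.commute add.left_commute\<close>)+

lemma s_Y_Y_op_other:
  "j \<noteq> i \<Longrightarrow> j \<noteq> Suc i \<Longrightarrow> s_Y n i (Y_op n j x) = Y_op n j (s_Y n i x)"
  by (rule tlin_eq_upd2[OF _ _ x, of _ _ i], (rule tlin_op_intros)+,
      use n i in \<open>simp add: op_upd2[OF n i]\<close>)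

lemma mult_Y_ratio_Y_op: "mult_Y_ratio n i (Y_op n j x) = Y_op n j (mult_Y_ratio n i x)"
  by (rule tlin_eq_upd2[OF _ _ x, of _ _ i], (rule tlin_op_intros)+,
      cases "j = i"; cases "j = Suc i")
     (use n i in \<open>simp_all add: op_upd2[OF n i] algebra_simps\<close>)

lemma mult_Y_ratio_Y_op_Suc: "Y_op n (Suc i) (mult_Y_ratio n i x) = Y_op n i x"
  by (rule tlin_eq_upd2[OF _ _ x, of _ _ i], (rule tlin_op_intros)+,
      use n i in \<open>simp add: op_upd2[OF n i]\<close>)

lemma s_Y_s_Y: "s_Y n i (s_Y n i x) = x"
  by (rule tlin_eq_upd2[OF _ _ x, of _ _ i], (rule tlin_op_intros)+,
      use n i in \<open>simp add: op_upd2[OF n i]\<close>)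

text \<open>The relation s u = u^-1 s, written as u s u = s to avoid introducing u^-1.\<close>

lemma mult_Y_ratio_s_Y_mult_Y_ratio: "mult_Y_ratio n i (s_Y n i (mult_Y_ratio n i x)) = s_Y n i x"
proof -
  have m: "(p - int n) div int n = p div int n - 1" "(p - int n) mod int n = p mod int n" for p
    using n div_add_self2[of "int n" "p - int n"] mod_add_self2[of "p - int n" "int n"] by simp_all
  show ?thesis
    by (rule tlin_eq_upd2[OF _ _ x, of _ _ i], (rule tlin_op_intros)+,
      use n i in \<open>simp add: m op_upd2[OF n i] algebra_simps\<close>)
qed

lemma R_op_Y_op: "R_op n v i (Y_op n j x) = Y_op n j (R_op n v i x)"
  by (rule tlin_eq_upd2[OF _ _ x, of _ _ i], (rule tlin_op_intros)+,
      cases "j = i"; cases "j = Suc i")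
     (use n i in \<open>simp_all add: op_upd2[OF n i] R_op_upd2[OF n i] op_lin Let_def distrib_left add.commute add.left_commute\<close>)

lemma R_op_s_Y: "R_op n v i (s_Y n i x) = s_Y n i (R_op n v i x)"
  by (rule tlin_eq_upd2[OF _ _ x, of _ _ i], (rule tlin_op_intros)+,
      use n i in \<open>simp add: op_upd2[OF n i] R_op_upd2[OF n i] op_lin Let_def\<close>)

lemma R_op_mult_Y_ratio: "R_op n v i (mult_Y_ratio n i x) = mult_Y_ratio n i (R_op n v i x)"
proof -
  have m: "(p - int n) div int n = p div int n - 1" "(p - int n) mod int n = p mod int n" for p
    using n div_add_self2[of "int n" "p - int n"] mod_add_self2[of "p - int n" "int n"] by simp_all
  show ?thesis
    by (rule tlin_eq_upd2[OF _ _ x, of _ _ i], (rule tlin_op_intros)+,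
      use n i in \<open>simp add: m op_upd2[OF n i] R_op_upd2[OF n i] op_lin Let_def algebra_simps\<close>)
qed

text \<open>With c = v - v^-1, on the span of e_a (x) e_b and e_b (x) e_a for a < b the matrix has
  rows (c, 1) and (1, 0), with characteristic polynomial X^2 - c X - 1; on e_a (x) e_a it is the
  root v of this polynomial.\<close>

lemma R_op_R_op:
  assumes "v \<noteq> 0"
  shows "R_op n v i (R_op n v i x) = x + scale (v - inverse v) (R_op n v i x)"
proof (rule tlin_eq_upd2[OF _ _ x, of _ _ i])
  fix t :: "int list" and p q assume "length t = N"
  then have R: "R_op n v i (e_upd2 i t p q) =
    (let p' = int n * (p div int n) + q mod int n; q' = int n * (q div int n) + p mod int n
     in if p mod int n = q mod int n then scale v (e_upd2 i t p q)
        else if p mod int n < q mod int n then e_upd2 i t p' q' + scale (v - inverse v) (e_upd2 i t p q)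
        else e_upd2 i t p' q')" for p q
    by (rule R_op_upd2[OF n i])
  consider "p mod int n = q mod int n" | "p mod int n < q mod int n" | "p mod int n > q mod int n"
    by linarith
  then show "R_op n v i (R_op n v i (e_upd2 i t p q)) =
    e_upd2 i t p q + scale (v - inverse v) (R_op n v i (e_upd2 i t p q))"
  proof cases
    case 1
    have "v * v = 1 + (v - inverse v) * v" using assms by (simp add: algebra_simps)
    then show ?thesis unfolding R using 1
      by (simp add: op_lin R) (metis tens.scale_left_distrib tens.scale_one)
  next
    case 2
    with n show ?thesis by (simp add: R op_lin Let_def)
  next
    case 3
    with n show ?thesis by (simp add: R op_lin Let_def)
  qed
qed (rule tlin_op_intros)+

text \<open>By uniqueness of the quotient, identities for the divided difference only need to be
  checked after multiplication by u - 1.\<close>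

lemma div_diff_opI:
  assumes "g \<in> tensor_space N" "y \<in> tensor_space N" "mult_Y_ratio n i g - g = s_Y n i y - y"
  shows "div_diff_op n i y = g"
  by (rule mult_Y_ratio_inject[OF n i]) (simp_all only: div_diff_op_eq[OF n i] assms div_diff_op_in_ts)

lemma mult_Y_ratio_div_diff_op:
  "mult_Y_ratio n i (div_diff_op n i x) = div_diff_op n i x + s_Y n i x - x"
  using div_diff_op_eq[OF n i x] by (simp add: algebra_simps)

end

context
  fixes n :: nat and N i :: nat and x :: tens
  assumes n: "n \<ge> 1" and i: "Suc i < N" and x: "x \<in> tensor_space N"
begin

lemmas hecke_simps = s_Y_Y_op[OF n i] s_Y_Y_op_other[OF n i] mult_Y_ratio_Y_op[OF n i]
  mult_Y_ratio_Y_op_Suc[OF n i] s_Y_s_Y[OF n i] R_op_Y_op[OF n i] R_op_s_Y[OF n i]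
  R_op_mult_Y_ratio[OF n i] mult_Y_ratio_div_diff_op[OF n i] op_lin

lemma div_diff_op_Y_op:
  "div_diff_op n i (Y_op n i x) = Y_op n (Suc i) (div_diff_op n i x) - Y_op n (Suc i) x"
  by (rule div_diff_opI[OF n i]) (use x in \<open>simp_all add: hecke_simps\<close>)

lemma div_diff_op_Y_op_Suc:
  "div_diff_op n i (Y_op n (Suc i) x) = Y_op n i (div_diff_op n i x) + Y_op n (Suc i) x"
  by (rule div_diff_opI[OF n i]) (use x in \<open>simp_all add: hecke_simps\<close>)

lemma div_diff_op_Y_op_other:
  "j \<noteq> i \<Longrightarrow> j \<noteq> Suc i \<Longrightarrow> div_diff_op n i (Y_op n j x) = Y_op n j (div_diff_op n i x)"
  by (rule div_diff_opI[OF n i]) (use x in \<open>simp_all add: hecke_simps\<close>)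

lemma div_diff_op_R_op: "div_diff_op n i (R_op n v i x) = R_op n v i (div_diff_op n i x)"
  by (rule div_diff_opI[OF n i])
     (use x in \<open>simp_all add: hecke_simps R_op_mult_Y_ratio[OF n i, symmetric]
        del: R_op_mult_Y_ratio[OF n i]\<close>)

end

context
  fixes n :: nat and N i :: nat and x :: tens
  assumes n: "n \<ge> 1" and i: "Suc i < N" and x: "x \<in> tensor_space N"
begin

text \<open>Formally s maps (sx - x)/(u - 1) to (x - sx)/(u^-1 - 1) = u (sx - x)/(u - 1). Instead of
  dividing by u^-1 - 1, the proof shows that the difference of both sides is fixed by u and hence
  zero.\<close>

lemma s_Y_div_diff_op: "s_Y n i (div_diff_op n i x) = mult_Y_ratio n i (div_diff_op n i x)"
proof -
  let ?g = "div_diff_op n i x"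
  let ?u = "mult_Y_ratio n i" and ?s = "s_Y n i"
  let ?h = "?s ?g - ?u ?g"
  have g: "?g \<in> tensor_space N" using x by simp
  have "?s (?u ?g - ?g) = ?s (?s x - x)"
    by (simp only: div_diff_op_eq[OF n i x])
  then have "?s (?u ?g) - ?s ?g = x - ?s x"
    using x by (simp add: hecke_simps[OF n i] op_lin del: mult_Y_ratio_div_diff_op[OF n i])
  also have "\<dots> = ?g - ?u ?g"
    using div_diff_op_eq[OF n i x] by (simp add: algebra_simps)
  finally have "?s (?u ?g) = ?s ?g + ?g - ?u ?g"
    by (simp add: algebra_simps)
  then have "?u (?s (?u ?g)) = ?u (?s ?g) + ?u ?g - ?u (?u ?g)"
    by (simp only: op_lin)
  then have "?u ?h = ?h"
    unfolding mult_Y_ratio_s_Y_mult_Y_ratio[OF n i g] op_lin by (simp add: algebra_simps)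
  from mult_Y_ratio_fixed[OF n i _ this] g show ?thesis by simp
qed

lemma div_diff_op_idem: "div_diff_op n i (div_diff_op n i x) = div_diff_op n i x"
  by (rule div_diff_opI[OF n i]) (use x in \<open>simp_all add: s_Y_div_diff_op\<close>)

lemma div_diff_op_s_Y: "div_diff_op n i (s_Y n i x) = - div_diff_op n i x"
proof (rule div_diff_opI[OF n i])
  show "mult_Y_ratio n i (- div_diff_op n i x) - - div_diff_op n i x = s_Y n i (s_Y n i x) - s_Y n i x"
    using div_diff_op_eq[OF n i x] s_Y_s_Y[OF n i x] by (simp add: op_lin algebra_simps)
qed (use x in simp_all)

text \<open>This and the next two lemmas are the Bernstein relations of the affine Hecke
  algebra.\<close>

lemma T_op_Y_op: "T_op n v i (Y_op n i x) = Y_op n (Suc i) (T_op n v i x) - scale (v - inverse v) (Y_op n (Suc i) x)"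
  using x by (simp add: T_op_def div_diff_op_Y_op[OF n i] hecke_simps[OF n i] tens.scale_right_diff_distrib)

lemma T_op_Y_op_Suc: "T_op n v i (Y_op n (Suc i) x) = Y_op n i (T_op n v i x) + scale (v - inverse v) (Y_op n (Suc i) x)"
  using x by (simp add: T_op_def div_diff_op_Y_op_Suc[OF n i] hecke_simps[OF n i] tens.scale_right_distrib)

lemma T_op_Y_op_other: "j \<noteq> i \<Longrightarrow> j \<noteq> Suc i \<Longrightarrow> T_op n v i (Y_op n j x) = Y_op n j (T_op n v i x)"
  using x by (simp add: T_op_def div_diff_op_Y_op_other[OF n i] hecke_simps[OF n i])

text \<open>Expand (sR + cD)^2. Here sRsR = R^2 = 1 + cR, the mixed terms give sRD + DsR = sR - R,
  and D^2 = D; the sum is 1 + c(sR + cD).\<close>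

lemma T_op_quadratic:
  assumes "v \<noteq> 0"
  shows "T_op n v i (T_op n v i x) = x + scale (v - inverse v) (T_op n v i x)"
proof -
  define c where "c = v - inverse v"
  let ?R = "R_op n v i" and ?D = "div_diff_op n i" and ?s = "s_Y n i"
  have sD: "?s (?D x) = ?D x + ?s x - x"
    using x by (simp add: s_Y_div_diff_op mult_Y_ratio_div_diff_op[OF n i])
  have sRD: "?s (?R (?D x)) = ?R (?D x) + ?s (?R x) - ?R x"
    using x by (simp add: R_op_s_Y[OF n i, symmetric] sD op_lin)
  have DsR: "?D (?s (?R x)) = - ?R (?D x)"
    using x by (simp add: R_op_s_Y[OF n i, symmetric] div_diff_op_R_op[OF n i] div_diff_op_s_Y op_lin)
  have sRsR: "?s (?R (?s (?R x))) = x + scale c (?R x)"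
    using x R_op_R_op[OF n i x assms] by (simp add: R_op_s_Y[OF n i] s_Y_s_Y[OF n i] c_def)
  show ?thesis
    unfolding T_op_def c_def[symmetric]
    by (simp add: op_lin sRD DsR sRsR div_diff_op_idem tens.scale_right_distrib tens.scale_right_diff_distrib)
qed

end

section \<open>Commutation and braid relations\<close>

lemma T_op_reduced:
  assumes n: "n \<ge> 1" and i: "Suc i < length t"
    and p: "0 \<le> p" "p < int n" and q: "0 \<le> q" "q < int n"
  shows "T_op n v i (e_upd2 i t p q) =
    (if p = q then scale v (e_upd2 i t p p)
     else if p < q then e_upd2 i t q p + scale (v - inverse v) (e_upd2 i t p q)
     else e_upd2 i t q p)"
  \<comment> \<open>Both exponents are 0, so the divided difference is an empty sum,
    \<open>s_Y\<close> acts trivially and only R remains.\<close>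
  using p q by (simp add: T_op_def R_op_upd2[OF n i refl] s_Y_upd2[OF n i refl] op_lin
      div_diff_op_basis Let_def i)

lemma T_op_commute:
  assumes n: "n \<ge> 1" and ij: "Suc i < N" "Suc j < N" "Suc i < j" and x: "x \<in> tensor_space N"
  shows "T_op n v i (T_op n v j x) = T_op n v j (T_op n v i x)"
proof -
  define Q where "Q = (\<lambda>x. T_op n v i (T_op n v j x) - T_op n v j (T_op n v i x))"
  have "Q x = 0"
  proof (rule zero_if_Y_equivariant[where Q = Q and N = N and \<sigma> = "Transposition.transpose i (Suc i) \<circ> Transposition.transpose j (Suc j)"
      and J = "{i, Suc i, j, Suc j}", OF n])
    show "tlin Q" unfolding Q_def by (rule tlin_op_intros)+
    fix k and y :: tens assume k: "k \<in> {i, Suc i, j, Suc j}" and y: "y \<in> tensor_space N"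
    note T = T_op_Y_op[OF n ij(1)] T_op_Y_op[OF n ij(2)] T_op_Y_op_Suc[OF n ij(1)] T_op_Y_op_Suc[OF n ij(2)]
      T_op_Y_op_other[OF n ij(1)] T_op_Y_op_other[OF n ij(2)]
    from k show "Q (Y_op n k y) =
        Y_op n ((Transposition.transpose i (Suc i) \<circ> Transposition.transpose j (Suc j)) k) (Q y)"
      using ij y by (elim insertE emptyE) (simp_all add: Q_def T T_op_lin op_lin)
  next
    fix t :: "int list" assume t: "length t = N" "\<forall>k\<in>{i, Suc i, j, Suc j}. 0 \<le> t ! k \<and> t ! k < int n"
    define e where "e = (\<lambda>a b c d. e_basis (upd2 i a b (upd2 j c d t)))"
    have e': "e a b c d = e_basis (upd2 j c d (upd2 i a b t))" for a b c d
      using ij by (simp add: e_def upd2_def list_update_swap)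
    have 1: "T_op n v i (e a b c d) = (if a = b then scale v (e a b c d)
     else if a < b then e b a c d + scale (v - inverse v) (e a b c d) else e b a c d)"
      if "0 \<le> a \<and> a < int n" "0 \<le> b \<and> b < int n" for a b c d
      unfolding e_def using T_op_reduced[OF n, of i "upd2 j c d t" a b] that t ij by simp
    have 2: "T_op n v j (e a b c d) = (if c = d then scale v (e a b c d)
     else if c < d then e a b d c + scale (v - inverse v) (e a b c d) else e a b d c)"
      if "0 \<le> c \<and> c < int n" "0 \<le> d \<and> d < int n" for a b c d
      unfolding e' using T_op_reduced[OF n, of j "upd2 i a b t" c d] that t ij by simp
    have "e_basis t = e (t ! i) (t ! Suc i) (t ! j) (t ! Suc j)"
      using ij t by (simp add: e_def upd2_self)
    then show "Q (e_basis t) = 0" using t(2)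
      by (simp add: Q_def 1 2 T_op_lin tens.scale_right_distrib add.left_commute tens.scale_left_commute)
  qed (use ij x in \<open>auto simp: Q_def Transposition.transpose_def\<close>)
  then show ?thesis by (simp add: Q_def)
qed

lemma T_op_braid:
  assumes n: "n \<ge> 1" and v: "v \<noteq> 0" and i: "Suc (Suc i) < N" and x: "x \<in> tensor_space N"
  shows "T_op n v i (T_op n v (Suc i) (T_op n v i x)) = T_op n v (Suc i) (T_op n v i (T_op n v (Suc i) x))"
proof -
  define c where "c = v - inverse v"
  define Q where "Q = (\<lambda>x. T_op n v i (T_op n v (Suc i) (T_op n v i x)) - T_op n v (Suc i) (T_op n v i (T_op n v (Suc i) x)))"
  have i1: "Suc i < N" using i by simp
  \<comment> \<open>Up to corrections, both sides permute the variables like s_i s_(i+1) s_i, the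
    transposition of i and i + 2. The Bernstein corrections create squares of generators, which the
    quadratic relation reduces before they cancel.\<close>
  have "Q x = 0"
  proof (rule zero_if_Y_equivariant[where Q = Q and N = N and \<sigma> = "Transposition.transpose i (Suc (Suc i))"
      and J = "{i, Suc i, Suc (Suc i)}", OF n])
    show "tlin Q" unfolding Q_def by (rule tlin_op_intros)+
    fix k and y :: tens assume k: "k \<in> {i, Suc i, Suc (Suc i)}" and y: "y \<in> tensor_space N"
    note T = T_op_Y_op[OF n i1] T_op_Y_op[OF n i] T_op_Y_op_Suc[OF n i1] T_op_Y_op_Suc[OF n i]
      T_op_Y_op_other[OF n i1] T_op_Y_op_other[OF n i] T_op_quadratic[OF n i1 _ v] T_op_quadratic[OF n i _ v]
    from k show "Q (Y_op n k y) = Y_op n (Transposition.transpose i (Suc (Suc i)) k) (Q y)"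
      using y by (elim insertE emptyE)
       (simp_all add: Q_def T T_op_lin op_lin c_def[symmetric] tens.scale_right_distrib tens.scale_right_diff_distrib)
  next
    fix t :: "int list" assume t: "length t = N" "\<forall>k\<in>{i, Suc i, Suc (Suc i)}. 0 \<le> t ! k \<and> t ! k < int n"
    define e where "e = (\<lambda>a b d. e_basis (t[i := a, Suc i := b, Suc (Suc i) := d]))"
    have 1: "T_op n v i (e a b d) = (if a = b then scale v (e a b d)
     else if a < b then e b a d + scale c (e a b d) else e b a d)"
      if "0 \<le> a \<and> a < int n" "0 \<le> b \<and> b < int n" for a b d
    proof -
      have "e a b d = e_upd2 i (t[Suc (Suc i) := d]) a b" for a b d
        by (simp add: e_def upd2_def list_update_swap)
      then show ?thesis using T_op_reduced[OF n, of i "t[Suc (Suc i) := d]" a b v] that t(1) i1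
        by (simp add: c_def)
    qed
    have 2: "T_op n v (Suc i) (e a b d) = (if b = d then scale v (e a b d)
     else if b < d then e a d b + scale c (e a b d) else e a d b)"
      if "0 \<le> b \<and> b < int n" "0 \<le> d \<and> d < int n" for a b d
    proof -
      have "e a b d = e_upd2 (Suc i) (t[i := a]) b d" for a b d
        by (simp add: e_def upd2_def)
      then show ?thesis using T_op_reduced[OF n, of "Suc i" "t[i := a]" b d v] that t(1) i
        by (simp add: c_def)
    qed
    have vv: "v * v = 1 + c * v" using v by (simp add: c_def algebra_simps)
    have "e_basis t = e (t ! i) (t ! Suc i) (t ! Suc (Suc i))"
      by (simp add: e_def)
    \<comment> \<open>The rules \<open>1\<close> and \<open>2\<close> depend only on the relative
      order of a, b and d, so it suffices to run through all orderings.\<close>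
    moreover have "Q (e a b d) = 0" if h: "0 \<le> a \<and> a < int n" "0 \<le> b \<and> b < int n" "0 \<le> d \<and> d < int n" for a b d
      by (insert linorder_less_linear[of a b] linorder_less_linear[of b d] linorder_less_linear[of a d],
          elim disjE; insert h; simp add: Q_def 1 2 T_op_lin tens.scale_right_distrib algebra_simps tens.scale_left_distrib vv)
    ultimately show "Q (e_basis t) = 0" using t(2) by simp
  qed (use i x in \<open>auto simp: Q_def Transposition.transpose_def\<close>)
  then show ?thesis by (simp add: Q_def)
qed

section \<open>Triangular form of the generators on pairs of indices\<close>

definition alpha_coeff :: "nat \<Rightarrow> complex \<Rightarrow> int \<Rightarrow> int \<Rightarrow> complex" where
  "alpha_coeff n v p q = (if int n dvd q - p then if p \<le> q then v else inverse v else 1)"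

text \<open>In T(e_p (x) e_q), \<open>alpha_coeff\<close> belongs to the exchanged pair and
  \<open>beta_coeff\<close> to the pair itself. For p = q the two pairs coincide and the whole
  eigenvalue v is put into \<open>alpha_coeff\<close>.\<close>

definition beta_coeff :: "complex \<Rightarrow> int \<Rightarrow> int \<Rightarrow> complex" where
  "beta_coeff v p q = (if p < q then v - inverse v else 0)"

text \<open>F is a linear combination of the values of G on I whose coefficients do not depend on G.
  Only their existence matters, so they are hidden behind a quantifier.\<close>

definition comb :: "int set \<Rightarrow> ((int \<Rightarrow> tens) \<Rightarrow> tens) \<Rightarrow> bool" where
  "comb I F \<longleftrightarrow> (\<exists>\<gamma>. \<forall>G. F G = (\<Sum>x\<in>I. scale (\<gamma> x) (G x)))"

lemma comb_single:
  assumes "finite I" "x \<in> I"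
  shows "comb I (\<lambda>G. G x)"
  unfolding comb_def
proof (intro exI allI)
  fix G :: "int \<Rightarrow> tens"
  have "(\<Sum>y\<in>I. scale (if y = x then 1 else 0) (G y)) = (\<Sum>y\<in>I. if y = x then G y else 0)"
    by (rule sum.cong) auto
  then show "G x = (\<Sum>y\<in>I. scale (if y = x then 1 else 0) (G y))" using assms by simp
qed

lemma comb_zero: "comb I (\<lambda>G. 0)"
  unfolding comb_def by (rule exI[of _ "\<lambda>_. 0"]) simp

lemma comb_add: "comb I F \<Longrightarrow> comb I F' \<Longrightarrow> comb I (\<lambda>G. F G + F' G)"
  unfolding comb_def
proof (elim exE)
  fix \<gamma> \<gamma>' assume "\<forall>G. F G = (\<Sum>x\<in>I. scale (\<gamma> x) (G x))" "\<forall>G. F' G = (\<Sum>x\<in>I. scale (\<gamma>' x) (G x))"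
  then show "\<exists>\<gamma>. \<forall>G. F G + F' G = (\<Sum>x\<in>I. scale (\<gamma> x) (G x))"
    by (intro exI[of _ "\<lambda>x. \<gamma> x + \<gamma>' x"]) (simp add: tens.scale_left_distrib sum.distrib)
qed

lemma comb_scale: "comb I F \<Longrightarrow> comb I (\<lambda>G. scale c (F G))"
  unfolding comb_def
proof (elim exE)
  fix \<gamma> assume "\<forall>G. F G = (\<Sum>x\<in>I. scale (\<gamma> x) (G x))"
  then show "\<exists>\<gamma>. \<forall>G. scale c (F G) = (\<Sum>x\<in>I. scale (\<gamma> x) (G x))"
    by (intro exI[of _ "\<lambda>x. c * \<gamma> x"]) (simp add: tens.scale_sum_right)
qed

lemma comb_sum: "(\<And>s. s \<in> A \<Longrightarrow> comb I (F s)) \<Longrightarrow> comb I (\<lambda>G. \<Sum>s\<in>A. F s G)"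
  by (induction A rule: infinite_finite_induct) (auto intro: comb_zero comb_add)

text \<open>\<open>T\<close> preserves the sum of the two indices, so a term of \<open>T(e\<^sub>p \<otimes> e\<^sub>q)\<close> is determined by its
  first index \<open>x\<close>. Quantifying over \<open>G\<close> makes the coefficients independent of the other tensor factors.\<close>

lemma T_op_comb:
  assumes n: "n \<ge> 1" and v: "v \<noteq> 0"
  obtains F where "comb {min p q<..<max p q} F"
    "\<And>i t. Suc i < length t \<Longrightarrow> T_op n v i (e_upd2 i t p q) =
       scale (alpha_coeff n v p q) (e_upd2 i t q p) + scale (beta_coeff v p q) (e_upd2 i t p q)
       + F (\<lambda>x. e_upd2 i t x (p + q - x))"
proof -
  define c where "c = v - inverse v"
  define a where "a = p mod int n"
  define b where "b = q mod int n"
  define d where "d = q div int n - p div int n"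
  \<comment> \<open>\<open>P s\<close> is the first index after multiplication by u^s. In particular
    \<open>P d\<close> has the exponent of q and the residue of p, so it is the index to which
    \<open>s_Y\<close> sends p.\<close>
  define P where "P = (\<lambda>s. p + int n * s)"
  have ab: "0 \<le> a" "a < int n" "0 \<le> b" "b < int n" using n by (auto simp: a_def b_def)
  have Pd: "q = P d + b - a" "int n * (q div int n) + a = P d" "int n * (p div int n) + b = p + q - P d"
    unfolding P_def d_def a_def b_def right_diff_distrib
    using mult_div_mod_eq[of "int n" p] mult_div_mod_eq[of "int n" q] by linarith+
  have m: "(int n * x + a) div int n = x" "(int n * x + a) mod int n = a"
    "(int n * x + b) div int n = x" "(int n * x + b) mod int n = b" for x
    using ab n by simp_all
  have P0: "P 0 = p" by (simp add: P_def)
  have Pmono: "P s + int n \<le> P s'" if "s < s'" for s s'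
    using mult_left_mono[of "s + 1" s' "int n"] that by (simp add: P_def distrib_left)
  have dvd: "int n dvd q - p \<longleftrightarrow> a = b"
    unfolding a_def b_def by (metis mod_eq_dvd_iff)
  define I where "I = {min p q<..<max p q}"
  have fin: "finite I" by (simp add: I_def)
  define K where "K = (\<lambda>G :: int \<Rightarrow> tens. (if a = b then scale v (G q) else if a < b then G q + scale c (G (P d))
     else G q) + scale c ((\<Sum>s\<in>{0..<d}. G (P s)) - (\<Sum>s\<in>{d..<0}. G (P s))))"
  have K: "T_op n v i (e_upd2 i t p q) = K (\<lambda>x. e_upd2 i t x (p + q - x))" if "Suc i < length t" for i t
  proof -
    have s1: "s_Y n i (e_upd2 i t p q) = e_upd2 i t (P d) (p + q - P d)"
      unfolding s_Y_upd2[OF n that refl] a_def[symmetric] b_def[symmetric] Pd(2,3) ..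
    have s2: "s_Y n i (e_upd2 i t (int n * (p div int n) + b) (int n * (q div int n) + a)) = e_upd2 i t q p"
      unfolding s_Y_upd2[OF n that refl] m by (simp add: a_def b_def)
    have D: "div_diff_op n i (e_upd2 i t p q) = (\<Sum>s\<in>{0..<d}. e_upd2 i t (P s) (p + q - P s))
        - (\<Sum>s\<in>{d..<0}. e_upd2 i t (P s) (p + q - P s))"
      using that by (simp add: div_diff_op_basis Let_def div_diff_term_def d_def P_def)
    show ?thesis
      unfolding T_op_def R_op_upd2[OF n that refl] D Let_def a_def[symmetric] b_def[symmetric]
    proof (cases "a = b")
      case True
      then have "P d = q" using Pd(1) by simp
      then show "s_Y n i (if a = b then scale v (e_upd2 i t p q)
          else if a < b then e_upd2 i t (int n * (p div int n) + b) (int n * (q div int n) + a) +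
            scale (v - inverse v) (e_upd2 i t p q)
          else e_upd2 i t (int n * (p div int n) + b) (int n * (q div int n) + a)) +
        scale (v - inverse v) ((\<Sum>s\<in>{0..<d}. e_upd2 i t (P s) (p + q - P s))
          - (\<Sum>s\<in>{d..<0}. e_upd2 i t (P s) (p + q - P s))) = K (\<lambda>x. e_upd2 i t x (p + q - x))"
        using True by (simp add: K_def op_lin s1 c_def)
    qed (simp add: K_def op_lin s1 s2 c_def)
  qed
  have "\<exists>F. comb I F \<and> (\<forall>G. K G = scale (alpha_coeff n v p q) (G q) + scale (beta_coeff v p q) (G p) + F G)"
  proof (cases p q rule: linorder_cases)
    case equal
    then have "d = 0" "a = b" by (simp_all add: d_def a_def b_def)
    then have "K G = scale (alpha_coeff n v p q) (G q) + scale (beta_coeff v p q) (G p) + 0" for G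
      using equal by (simp add: K_def alpha_coeff_def beta_coeff_def)
    then show ?thesis using comb_zero by blast
  next
    case less
    have d0: "d \<ge> 0"
    proof (rule ccontr)
      assume "\<not> d \<ge> 0"
      then have "P d + int n \<le> P 0" using Pmono[of d 0] by simp
      then show False using Pd(1) ab P0 less by linarith
    qed
    then have neg: "{d..<0} = {}" by simp
    have I1: "P s \<in> I" if "0 < s" "s < d" for s
      using that less Pmono[of 0 s] Pmono[of s d] P0 Pd(1) ab by (auto simp: I_def)
    have C: "comb I (\<lambda>G. scale c (\<Sum>s\<in>{1..<d}. G (P s)))"
      by (intro comb_scale comb_sum comb_single fin I1) auto
    \<comment> \<open>The term s = 0 is e_p (x) e_q itself and supplies \<open>beta_coeff\<close>;
      all later terms lie strictly between p and q.\<close>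
    have split: "(\<Sum>s\<in>{0..<d}. G (P s)) = G p + (\<Sum>s\<in>{1..<d}. G (P s))" if "d > 0" for G :: "int \<Rightarrow> tens"
    proof -
      have "{0..<d} = insert 0 {1..<d}" using that by auto
      then show ?thesis by (simp add: P0)
    qed
    show ?thesis
    proof (cases "a = b")
      case True
      then have "d > 0" using less d0 Pd(1) P0 by (cases "d = 0") auto
      then show ?thesis using C True less dvd
        by (intro exI[of _ "\<lambda>G. scale c (\<Sum>s\<in>{1..<d}. G (P s))"])
           (auto simp: K_def alpha_coeff_def beta_coeff_def c_def[symmetric] split neg tens.scale_right_distrib)
    next
      case ne: False
      show ?thesis
      proof (cases "d = 0")
        case True
        \<comment> \<open>For equal exponents the divided difference is empty, and the diagonal term
          of R sits at \<open>P d = p\<close>, so this time R supplies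
          \<open>beta_coeff\<close>.\<close>
        then have "a < b" using Pd(1) P0 less by simp
        then show ?thesis using ne less dvd True comb_zero P0
          by (intro exI[of _ "\<lambda>G. 0"])
             (auto simp: K_def alpha_coeff_def beta_coeff_def c_def[symmetric])
      next
        case False
        then have d: "d > 0" using d0 by simp
        show ?thesis
        proof (cases "a < b")
          case True
          \<comment> \<open>The diagonal term of R sits at \<open>P d = q - (b - a)\<close>,
            strictly between p and q.\<close>
          have "P d \<in> I" using Pmono[of 0 d] d True P0 Pd(1) n less by (auto simp: I_def)
          then have "comb I (\<lambda>G. scale c (G (P d)) + scale c (\<Sum>s\<in>{1..<d}. G (P s)))"
            by (intro comb_add C comb_scale comb_single fin)
          then show ?thesis using True less dvd d
            by (intro exI[of _ "\<lambda>G. scale c (G (P d)) + scale c (\<Sum>s\<in>{1..<d}. G (P s))"])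
               (auto simp: K_def alpha_coeff_def beta_coeff_def c_def[symmetric] split neg tens.scale_right_distrib)
        next
          case False
          then show ?thesis using C ne less dvd d
            by (intro exI[of _ "\<lambda>G. scale c (\<Sum>s\<in>{1..<d}. G (P s))"])
               (auto simp: K_def alpha_coeff_def beta_coeff_def c_def[symmetric] split neg tens.scale_right_distrib)
        qed
      qed
    qed
  next
    case greater
    have d0: "d \<le> 0"
    proof (rule ccontr)
      assume "\<not> d \<le> 0"
      then have "P 0 + int n \<le> P d" using Pmono[of 0 d] by simp
      then show False using Pd(1) ab P0 greater by linarith
    qed
    then have pos: "{0..<d} = {}" by simp
    have I1: "P s \<in> I" if "d < s" "s < 0" for s
      using that greater Pmono[of s 0] Pmono[of d s] P0 Pd(1) ab by (auto simp: I_def)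
    have C: "comb I (\<lambda>G. scale (- c) (\<Sum>s\<in>{d+1..<0}. G (P s)))"
      by (intro comb_scale comb_sum comb_single fin I1) auto
    \<comment> \<open>The term s = d needs care. For a = b it is \<open>G q\<close> and turns v into
      v - c = v^-1; for a < b it cancels the diagonal term of R; for b < a it lies strictly between
      q and p.\<close>
    have split: "(\<Sum>s\<in>{d..<0}. G (P s)) = G (P d) + (\<Sum>s\<in>{d+1..<0}. G (P s))" if "d < 0" for G :: "int \<Rightarrow> tens"
    proof -
      have "{d..<0} = insert d {d+1..<0}" using that by auto
      then show ?thesis by simp
    qed
    have ic: "inverse v = v - c" by (simp add: c_def)
    show ?thesis
    proof (cases "a = b")
      case True
      then have "d < 0" using greater d0 Pd(1) P0 by (cases "d = 0") auto
      moreover have "P d = q" using True Pd(1) by simp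
      ultimately show ?thesis using C True greater dvd
        by (intro exI[of _ "\<lambda>G. scale (- c) (\<Sum>s\<in>{d+1..<0}. G (P s))"])
           (auto simp: K_def alpha_coeff_def beta_coeff_def ic split pos tens.scale_right_diff_distrib tens.scale_right_distrib tens.scale_left_diff_distrib)
    next
      case ne: False
      show ?thesis
      proof (cases "a < b")
        case True
        then have "d < 0" using greater d0 Pd(1) P0 by (cases "d = 0") auto
        then show ?thesis using True greater dvd C
          by (intro exI[of _ "\<lambda>G. scale (- c) (\<Sum>s\<in>{d+1..<0}. G (P s))"])
             (auto simp: K_def alpha_coeff_def beta_coeff_def split pos tens.scale_right_diff_distrib tens.scale_right_distrib)
      next
        case False
        have "comb I (\<lambda>G. scale (- c) (\<Sum>s\<in>{d..<0}. G (P s)))"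
        proof (intro comb_scale comb_sum comb_single fin)
          fix s assume s: "s \<in> {d..<0}"
          show "P s \<in> I"
          proof (cases "s = d")
            case True
            then show ?thesis using s Pmono[of d 0] False ne P0 Pd(1) n greater by (auto simp: I_def)
          qed (use I1 s in auto)
        qed
        then show ?thesis using False ne greater dvd
          by (intro exI[of _ "\<lambda>G. scale (- c) (\<Sum>s\<in>{d..<0}. G (P s))"])
             (auto simp: K_def alpha_coeff_def beta_coeff_def pos)
      qed
    qed
  qed
  then obtain F where "comb I F"
    "\<And>G. K G = scale (alpha_coeff n v p q) (G q) + scale (beta_coeff v p q) (G p) + F G" by blast
  with that[of F] K show ?thesis unfolding I_def by simp
qed

text \<open>One choice of the intermediate coefficients that works for all positions and all lists
  at once; their values are never computed.\<close>

definition gamma_coeff :: "nat \<Rightarrow> complex \<Rightarrow> int \<Rightarrow> int \<Rightarrow> int \<Rightarrow> complex" where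
  "gamma_coeff n v p q = (SOME \<gamma>. \<forall>i t. Suc i < length t \<longrightarrow> T_op n v i (e_upd2 i t p q) =
       scale (alpha_coeff n v p q) (e_upd2 i t q p) + scale (beta_coeff v p q) (e_upd2 i t p q)
       + (\<Sum>x\<in>{min p q<..<max p q}. scale (\<gamma> x) (e_upd2 i t x (p + q - x))))"

lemma T_op_upd2:
  assumes "n \<ge> 1" "v \<noteq> 0" "Suc i < length t"
  shows "T_op n v i (e_upd2 i t p q) =
       scale (alpha_coeff n v p q) (e_upd2 i t q p) + scale (beta_coeff v p q) (e_upd2 i t p q)
       + (\<Sum>x\<in>{min p q<..<max p q}. scale (gamma_coeff n v p q x) (e_upd2 i t x (p + q - x)))"
proof -
  from T_op_comb[OF assms(1,2)] obtain F where F: "comb {min p q<..<max p q} F"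
    "\<And>i t. Suc i < length t \<Longrightarrow> T_op n v i (e_upd2 i t p q) =
       scale (alpha_coeff n v p q) (e_upd2 i t q p) + scale (beta_coeff v p q) (e_upd2 i t p q)
       + F (\<lambda>x. e_upd2 i t x (p + q - x))" by blast
  from F(1) obtain \<gamma> where "\<And>G. F G = (\<Sum>x\<in>{min p q<..<max p q}. scale (\<gamma> x) (G x))"
    unfolding comb_def by blast
  with F(2) have "\<exists>\<gamma>. \<forall>i t. Suc i < length t \<longrightarrow> T_op n v i (e_upd2 i t p q) =
       scale (alpha_coeff n v p q) (e_upd2 i t q p) + scale (beta_coeff v p q) (e_upd2 i t p q)
       + (\<Sum>x\<in>{min p q<..<max p q}. scale (\<gamma> x) (e_upd2 i t x (p + q - x)))"
    by (intro exI[of _ \<gamma>]) simp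
  from someI_ex[OF this] assms(3) show ?thesis unfolding gamma_coeff_def by blast
qed

section \<open>Appending and slicing\<close>

definition app :: "int \<Rightarrow> tens \<Rightarrow> tens" where
  "app k = lin_ext (\<lambda>t. e_basis (t @ [k]))"

lemma tlin_app: "tlin (app k)"
  unfolding app_def by (rule tlin_lin_ext)

lemmas app_lin = tlin_simps[OF tlin_app] tens2.linear_sum[OF tlin_app]

lemma app_basis [simp]: "app k (e_basis t) = e_basis (t @ [k])"
  by (simp add: app_def)

lemma app_in_ts [simp]: "x \<in> tensor_space N \<Longrightarrow> app k x \<in> tensor_space (Suc N)"
  unfolding app_def by (erule lin_ext_in_ts) simp

definition slice :: "int \<Rightarrow> tens \<Rightarrow> tens" where
  "slice k = Poly_Mapping.map_key (\<lambda>t. t @ [k])"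

lemma lookup_slice [simp]: "Poly_Mapping.lookup (slice k w) t = Poly_Mapping.lookup w (t @ [k])"
  unfolding slice_def by (subst map_key.rep_eq) (auto simp: inj_on_def)

lemma tlin_slice: "tlin (slice k)"
  by (rule tlinI) (auto intro: poly_mapping_eqI simp: lookup_add)

lemmas slice_lin = tlin_simps[OF tlin_slice] tens2.linear_sum[OF tlin_slice]

lemma slice_in_ts [simp]: "w \<in> tensor_space (Suc N) \<Longrightarrow> slice k w \<in> tensor_space N"
  by (force simp: tensor_space_def in_keys_iff)

lemma tens_snoc_induct [consumes 1]:
  assumes "x \<in> tensor_space (Suc N)" "tlin f" "tlin g"
    and "\<And>t k. length t = N \<Longrightarrow> f (e_basis (t @ [k])) = g (e_basis (t @ [k]))"
  shows "f x = g x"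
  by (rule tlin_eqI[OF assms(2,3,1)]) (metis assms(4) length_Suc_conv_rev)

lemma slice_basis: "slice k (e_basis (t @ [l])) = (if k = l then e_basis t else 0)"
  by (auto intro!: poly_mapping_eqI simp: lookup_e_basis)

lemma slice_app: "x \<in> tensor_space N \<Longrightarrow> slice k (app l x) = (if k = l then x else 0)"
proof -
  assume x: "x \<in> tensor_space N"
  have "slice k (app l x) = scale (if k = l then 1 else 0) x"
    by (rule tlin_eqI[OF _ _ x]) (auto intro!: tlin_compose[OF tlin_slice] tlin_app tlin_scale_fun tlin_ident simp: slice_basis)
  then show ?thesis by simp
qed

lemma slice_eqI:
  assumes "w \<in> tensor_space (Suc N)" "w' \<in> tensor_space (Suc N)" "\<And>k. slice k w = slice k w'"
  shows "w = w'"
proof (rule poly_mapping_eqI)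
  fix t
  show "Poly_Mapping.lookup w t = Poly_Mapping.lookup w' t"
  proof (cases "length t = Suc N")
    case True
    then obtain t' k where "t = t' @ [k]" by (metis length_Suc_conv_rev)
    then show ?thesis using arg_cong[OF assms(3)[of k], of "\<lambda>x. Poly_Mapping.lookup x t'"] by simp
  next
    case False
    then have "t \<notin> Poly_Mapping.keys w" "t \<notin> Poly_Mapping.keys w'"
      using assms(1,2) by (auto simp: tensor_space_def)
    then show ?thesis by (simp add: in_keys_iff)
  qed
qed

definition last_indices :: "tens \<Rightarrow> int set" where
  "last_indices w = last ` Poly_Mapping.keys w"

lemma finite_last_indices [simp]: "finite (last_indices w)"
  by (simp add: last_indices_def)

lemma slice_eq_0: "k \<notin> last_indices w \<Longrightarrow> slice k w = 0"
  by (rule poly_mapping_eqI) (force simp: last_indices_def in_keys_iff)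

lemma slices_expansion:
  assumes "w \<in> tensor_space (Suc N)"
  shows "w = (\<Sum>k\<in>last_indices w. app k (slice k w))"
proof -
  let ?A = "last_indices w"
  have "slice l w = slice l (\<Sum>k\<in>?A. app k (slice k w))" for l
  proof -
    have "slice l (\<Sum>k\<in>?A. app k (slice k w)) = (\<Sum>k\<in>?A. if l = k then slice k w else 0)"
      unfolding slice_lin using assms by (intro sum.cong refl slice_app[of _ N]) simp
    also have "\<dots> = slice l w" using slice_eq_0[of l w] by simp
    finally show ?thesis ..
  qed
  then show ?thesis
    by - (rule slice_eqI[OF assms], rule ts_sum, rule app_in_ts, rule slice_in_ts, rule assms)
qed

lemma T_op_app:
  assumes "n \<ge> 1" "v \<noteq> 0" "Suc i < N" "x \<in> tensor_space N"
  shows "T_op n v i (app k x) = app k (T_op n v i x)"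
proof (rule tlin_eqI[OF _ _ assms(4)])
  fix t :: "int list" assume t: "length t = N"
  have e: "e_upd2 i (t @ [k]) p q = app k (e_upd2 i t p q)" for p q
    using assms(3) t by (simp add: upd2_def list_update_append1)
  have "T_op n v i (e_upd2 i (t @ [k]) p q) = app k (T_op n v i (e_upd2 i t p q))" for p q
    using assms(1-3) t by (simp add: T_op_upd2 e[symmetric] app_lin del: app_basis)
  from this[of "t ! i" "t ! Suc i"] show "T_op n v i (app k (e_basis t)) = app k (T_op n v i (e_basis t))"
    unfolding e by (simp add: upd2_self)
qed (rule tlin_compose[OF tlin_app] tlin_compose[OF tlin_T_op] tlin_T_op tlin_app)+

lemma T_op_slice:
  assumes "n \<ge> 1" "v \<noteq> 0" "Suc i < N" "w \<in> tensor_space (Suc N)"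
  shows "slice k (T_op n v i w) = T_op n v i (slice k w)"
proof (rule tens_snoc_induct[OF assms(4)])
  fix t :: "int list" and l assume t: "length t = N"
  have "T_op n v i (e_basis (t @ [l])) = app l (T_op n v i (e_basis t))"
    using T_op_app[OF assms(1-3), of "e_basis t" l] t by simp
  then show "slice k (T_op n v i (e_basis (t @ [l]))) = T_op n v i (slice k (e_basis (t @ [l])))"
    using t by (simp add: slice_app[of _ N] slice_basis T_op_lin)
qed (rule tlin_compose[OF tlin_slice] tlin_compose[OF tlin_T_op] tlin_T_op tlin_slice)+

lemma T_op_app_app:
  assumes "n \<ge> 1" "v \<noteq> 0" "x \<in> tensor_space N"
  shows "T_op n v N (app q (app p x)) =
    scale (alpha_coeff n v p q) (app p (app q x)) + scale (beta_coeff v p q) (app q (app p x))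
    + (\<Sum>y\<in>{min p q<..<max p q}. scale (gamma_coeff n v p q y) (app (p + q - y) (app y x)))"
proof (rule tlin_eqI[OF _ _ assms(3)])
  fix t :: "int list" assume t: "length t = N"
  have e: "app b (app a (e_basis t)) = e_upd2 N (t @ [p, q]) a b" for a b
    using t by (simp add: upd2_def list_update_append)
  have "Suc N < length (t @ [p, q])" using t by simp
  from T_op_upd2[OF assms(1,2) this, of p q]
  show "T_op n v N (app q (app p (e_basis t))) =
    scale (alpha_coeff n v p q) (app p (app q (e_basis t))) + scale (beta_coeff v p q) (app q (app p (e_basis t)))
    + (\<Sum>y\<in>{min p q<..<max p q}. scale (gamma_coeff n v p q y) (app (p + q - y) (app y (e_basis t))))"
    unfolding e .
qed (rule tlin_app tlin_add_fun tlin_scale_fun tlin_sum_fun tlin_compose[OF tlin_app] tlin_compose[OF tlin_T_op])+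

section \<open>Reduced words\<close>

abbreviation adj :: "nat \<Rightarrow> nat \<Rightarrow> nat" where
  "adj i \<equiv> Transposition.transpose i (Suc i)"

definition word_perm :: "nat list \<Rightarrow> nat \<Rightarrow> nat" where
  "word_perm is = foldr (\<lambda>i p. adj i \<circ> p) is id"

lemma word_perm_simps [simp]:
  "word_perm [] = id" "word_perm (i # is) = adj i \<circ> word_perm is"
  by (simp_all add: word_perm_def)

lemma word_perm_append: "word_perm (is @ js) = word_perm is \<circ> word_perm js"
  by (induction "is") (simp_all add: comp_assoc)

lemma adj_permutes: "Suc i < N \<Longrightarrow> adj i permutes {..<N}"
  by (rule permutes_swap_id) auto

lemma word_perm_permutes: "\<forall>i\<in>set is. Suc i < N \<Longrightarrow> word_perm is permutes {..<N}"
  by (induction "is") (auto intro: permutes_compose adj_permutes)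

lemma adj_adj_comp [simp]: "adj i \<circ> (adj i \<circ> w) = w"
  by (simp add: comp_assoc[symmetric])

definition inversions :: "nat \<Rightarrow> (nat \<Rightarrow> nat) \<Rightarrow> (nat \<times> nat) set" where
  "inversions N w = {(i, j). i < j \<and> j < N \<and> w j < w i}"

lemma perm_length_eq: "perm_length N w = card (inversions N w)"
  by (simp add: perm_length_def inversions_def)

lemma finite_inversions [simp]: "finite (inversions N w)"
  by (rule finite_subset[of _ "{..<N} \<times> {..<N}"]) (auto simp: inversions_def)

lemma perm_length_id [simp]: "perm_length N id = 0"
proof -
  have "inversions N id = {}" by (auto simp: inversions_def)
  then show ?thesis by (simp add: perm_length_eq)
qed

text \<open>Sending an inversion (i, j) of w to (w j, w i) is injective into the inversions of the
  inverse; applying this to w and to its inverse gives both inequalities.\<close>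

lemma perm_length_inv:
  assumes "w permutes {..<N}"
  shows "perm_length N (inv w) = perm_length N w"
proof -
  have sub: "(\<lambda>(i, j). (w j, w i)) ` inversions N w \<subseteq> inversions N (inv w)" if "w permutes {..<N}" for w
    using permutes_in_image[OF that] permutes_inverses[OF that] by (auto simp: inversions_def)
  have le: "perm_length N w \<le> perm_length N (inv w)" if w: "w permutes {..<N}" for w
  proof -
    have "inj_on (\<lambda>(i, j). (w j, w i)) (inversions N w)"
      using permutes_inj[OF w] by (auto simp: inj_on_def inj_def)
    from card_image[OF this] show ?thesis
      using card_mono[OF finite_inversions sub[OF w]] by (simp add: perm_length_eq)
  qed
  show ?thesis
    using le[OF assms] le[OF permutes_inv[OF assms]] permutes_inv_inv[OF assms] by simp
qed

text \<open>Relabelling by the adjacent transposition carries the inversions of w to those of the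
  product, except for the one new inversion (i, i + 1).\<close>

lemma perm_length_adj_right:
  assumes w: "w permutes {..<N}" and i: "Suc i < N" and less: "w i < w (Suc i)"
  shows "perm_length N (w \<circ> adj i) = Suc (perm_length N w)"
proof -
  let ?f = "\<lambda>(a, b). (adj i a, adj i b)"
  have "inversions N (w \<circ> adj i) = insert (i, Suc i) (?f ` inversions N w)"
  proof (rule set_eqI, clarify)
    fix a b
    have "(a, b) \<in> ?f ` inversions N w \<longleftrightarrow> (adj i a, adj i b) \<in> inversions N w"
      by (force simp: image_iff)
    then show "(a, b) \<in> inversions N (w \<circ> adj i) \<longleftrightarrow> (a, b) \<in> insert (i, Suc i) (?f ` inversions N w)"
      using i less by (auto simp: inversions_def Transposition.transpose_def split: if_splits)
  qed
  moreover have "(i, Suc i) \<notin> ?f ` inversions N w"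
    by (auto simp: inversions_def Transposition.transpose_def split: if_splits)
  moreover have "inj_on ?f (inversions N w)"
    by (rule inj_onI) (auto dest: injD[OF inj_transpose])
  ultimately show ?thesis by (simp add: perm_length_eq card_image)
qed

lemma perm_length_adj_left:
  assumes w: "w permutes {..<N}" and i: "Suc i < N" and less: "inv w i < inv w (Suc i)"
  shows "perm_length N (adj i \<circ> w) = Suc (perm_length N w)"
proof -
  have "inv (adj i \<circ> w) = inv w \<circ> adj i"
    by (simp add: o_inv_distrib permutes_bij[OF w])
  moreover have "adj i \<circ> w permutes {..<N}"
    by (rule permutes_compose[OF w adj_permutes[OF i]])
  ultimately show ?thesis
    using perm_length_adj_right[OF permutes_inv[OF w] i less] perm_length_inv w by metis
qed

lemma inv_adj_comp: "w permutes {..<N} \<Longrightarrow> inv (adj i \<circ> w) a = inv w (adj i a)"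
  by (simp add: o_inv_distrib permutes_bij)

lemma inv_neq: "w permutes {..<N} \<Longrightarrow> a \<noteq> b \<Longrightarrow> inv w a \<noteq> inv w b"
  by (metis permutes_inverses(1))

lemma perm_length_adj_left_descent:
  assumes w: "w permutes {..<N}" and i: "Suc i < N" and less: "inv w (Suc i) < inv w i"
  shows "perm_length N w = Suc (perm_length N (adj i \<circ> w))"
  using perm_length_adj_left[OF permutes_compose[OF w adj_permutes[OF i]] i] less
  by (simp add: inv_adj_comp[OF w])

lemma perm_length_word_le:
  "\<forall>i\<in>set is. Suc i < N \<Longrightarrow> perm_length N (word_perm is) \<le> length is"
proof (induction "is")
  case (Cons i "is")
  then have w: "word_perm is permutes {..<N}" and i: "Suc i < N" by (auto intro: word_perm_permutes)
  have "perm_length N (adj i \<circ> word_perm is) \<le> Suc (perm_length N (word_perm is))"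
    using perm_length_adj_left[OF w i] perm_length_adj_left_descent[OF w i] inv_neq[OF w, of i "Suc i"]
    by (cases "inv (word_perm is) i < inv (word_perm is) (Suc i)") auto
  also have "\<dots> \<le> length (i # is)" using Cons by simp
  finally show ?case by (simp only: word_perm_simps)
qed simp

lemma reduced_word_alt:
  "reduced_word N w is \<longleftrightarrow> (\<forall>i\<in>set is. Suc i < N) \<and> w = word_perm is \<and> length is = perm_length N w"
  by (simp add: reduced_word_def word_perm_def)

lemma reduced_word_permutes: "reduced_word N w is \<Longrightarrow> w permutes {..<N}"
  by (auto simp: reduced_word_alt intro: word_perm_permutes)

text \<open>If the first letter were not a left descent, removing it from w would lengthen the
  permutation, yet the tail is a word for the result with one letter less than the length of
  w.\<close>

lemma reduced_word_ConsD:
  assumes "reduced_word N w (i # is)"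
  shows "Suc i < N" "inv w (Suc i) < inv w i" "reduced_word N (adj i \<circ> w) is"
proof -
  show i: "Suc i < N" using assms by (simp add: reduced_word_alt)
  have w: "w permutes {..<N}" by (rule reduced_word_permutes[OF assms])
  have w': "adj i \<circ> w = word_perm is" using assms by (simp add: reduced_word_alt)
  have le: "perm_length N (adj i \<circ> w) \<le> length is"
    unfolding w' using assms by (intro perm_length_word_le) (simp add: reduced_word_alt)
  show *: "inv w (Suc i) < inv w i"
  proof (rule ccontr)
    assume "\<not> ?thesis"
    then have "inv w i < inv w (Suc i)" using inv_neq[OF w, of i "Suc i"] by simp
    from perm_length_adj_left[OF w i this] le assms show False by (simp add: reduced_word_alt)
  qed
  show "reduced_word N (adj i \<circ> w) is"
    using perm_length_adj_left_descent[OF w i *] assms w' by (auto simp: reduced_word_alt)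
qed

lemma reduced_word_ConsI:
  assumes "w permutes {..<N}" "Suc i < N" "inv w (Suc i) < inv w i" "reduced_word N (adj i \<circ> w) is"
  shows "reduced_word N w (i # is)"
  using perm_length_adj_left_descent[OF assms(1-3)] assms
  by (auto simp: reduced_word_alt) (metis adj_adj_comp)

lemma permutes_increasing_id:
  assumes w: "w permutes {..<N}" and inc: "\<And>i. Suc i < N \<Longrightarrow> w i < w (Suc i)"
  shows "w = id"
proof
  fix x
  have lt: "w y < N" if "y < N" for y using permutes_in_image[OF w, of y] that by simp
  have ge: "y \<le> w y" if "y < N" for y
    using that
  proof (induction y)
    case (Suc y)
    then show ?case using inc[of y] by simp
  qed simp
  have le: "w (N - Suc y) \<le> N - Suc y" if "y < N" for y
    using that
  proof (induction y)
    case 0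
    then show ?case using lt[of "N - 1"] by simp
  next
    case (Suc y)
    then have "Suc (N - Suc (Suc y)) = N - Suc y" by simp
    with Suc inc[of "N - Suc (Suc y)"] show ?case by simp
  qed
  show "w x = id x"
  proof (cases "x < N")
    case True
    then have "N - Suc (N - Suc x) = x" by simp
    then show ?thesis using ge[OF True] le[of "N - Suc x"] True by simp
  qed (use permutes_not_in[OF w] in simp)
qed

text \<open>A permutation without left descents is increasing and hence the identity; otherwise
  stripping off a left descent lowers the length.\<close>

lemma reduced_word_exists:
  assumes "w permutes {..<N}"
  shows "\<exists>is. reduced_word N w is"
  using assms
proof (induction "perm_length N w" arbitrary: w rule: less_induct)
  case less
  show ?case
  proof (cases "w = id")
    case True
    then show ?thesis by (intro exI[of _ "[]"]) (simp add: reduced_word_alt)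
  next
    case False
    have "inv w \<noteq> id" using False inv_inv_eq[OF permutes_bij[OF less.prems]] by auto
    then obtain i where i: "Suc i < N" "\<not> inv w i < inv w (Suc i)"
      using permutes_increasing_id[OF permutes_inv[OF less.prems]] by blast
    then have d: "inv w (Suc i) < inv w i" using inv_neq[OF less.prems, of i "Suc i"] by simp
    from less.hyps[of "adj i \<circ> w"] perm_length_adj_left_descent[OF less.prems i(1) d]
      permutes_compose[OF less.prems adj_permutes[OF i(1)]]
    obtain "is" where "reduced_word N (adj i \<circ> w) is" by auto
    from reduced_word_ConsI[OF less.prems i(1) d this] show ?thesis by blast
  qed
qed

lemma reduced_word_snoc:
  assumes "reduced_word N w is" "Suc i < N" "w i < w (Suc i)"
  shows "reduced_word N (w \<circ> adj i) (is @ [i])"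
  using assms perm_length_adj_right[OF reduced_word_permutes[OF assms(1)] assms(2,3)]
  by (auto simp: reduced_word_alt word_perm_append)

lemma reduced_word_Cons_up:
  assumes "reduced_word N w is" "Suc i < N" "inv w i < inv w (Suc i)"
  shows "reduced_word N (adj i \<circ> w) (i # is)"
  using assms perm_length_adj_left[OF reduced_word_permutes[OF assms(1)] assms(2,3)]
  by (auto simp: reduced_word_alt)

lemma foldr_closed:
  assumes "\<And>i x. i \<in> set is \<Longrightarrow> x \<in> X \<Longrightarrow> T i x \<in> X" "x \<in> X"
  shows "foldr T is x \<in> X"
  using assms by (induction "is") auto

text \<open>
  Matsumoto's theorem. If two reduced words of \<open>w\<close> start with different letters \<open>i\<close> and \<open>j\<close>, then
  both are descents of \<open>w\<close>, so \<open>w\<close> also has reduced words that start with the two words for the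
  longest element of \<open>\<langle>s\<^sub>i, s\<^sub>j\<rangle>\<close>; these connect the given words.
\<close>

lemma foldr_reduced_word_unique:
  fixes T :: "nat \<Rightarrow> 'a \<Rightarrow> 'a"
  assumes closed: "\<And>i x. Suc i < N \<Longrightarrow> x \<in> X \<Longrightarrow> T i x \<in> X"
    and comm: "\<And>i j x. Suc i < j \<Longrightarrow> Suc j < N \<Longrightarrow> x \<in> X \<Longrightarrow> T i (T j x) = T j (T i x)"
    and braid: "\<And>i x. Suc (Suc i) < N \<Longrightarrow> x \<in> X \<Longrightarrow>
      T i (T (Suc i) (T i x)) = T (Suc i) (T i (T (Suc i) x))"
    and "reduced_word N w is" "reduced_word N w js" "x \<in> X"
  shows "foldr T is x = foldr T js x"
  using assms(4,5)
proof (induction "length is" arbitrary: w "is" js rule: less_induct)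
  case less
  have red: "\<exists>ks. reduced_word N u ks" if "u permutes {..<N}" for u
    using reduced_word_exists[OF that] .
  have w: "w permutes {..<N}" by (rule reduced_word_permutes[OF less.prems(1)])
  have len: "length is = length js" using less.prems by (simp add: reduced_word_alt)
  have in_X: "foldr T ks x \<in> X" if "reduced_word N u ks" for u ks
    using that assms(6) closed by (intro foldr_closed) (auto simp: reduced_word_alt)
  \<comment> \<open>The induction hypothesis is passed in explicitly, so that the case j < i can
    reuse this step with the two words exchanged.\<close>
  have step: "foldr T (i # is') x = foldr T (j # js') x"
    if ij: "i < j" and ri: "reduced_word N w (i # is')" and rj: "reduced_word N w (j # js')"
      and IH: "\<And>v ks ls. length ks < length (i # is') \<Longrightarrow> reduced_word N v ks \<Longrightarrow> reduced_word N v ls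
        \<Longrightarrow> foldr T ks x = foldr T ls x" for i j is' js'
  proof -
    note i = reduced_word_ConsD[OF ri] and j = reduced_word_ConsD[OF rj]
    have wi: "adj i \<circ> w permutes {..<N}" and wj: "adj j \<circ> w permutes {..<N}"
      using i(3) j(3) by (auto intro: reduced_word_permutes)
    have "length (i # is') = perm_length N w" "length (j # js') = perm_length N w"
      using ri rj unfolding reduced_word_alt by blast+
    then have l: "length is' = length js'" by simp
    show ?thesis
    proof (cases "j = Suc i")
      case False
      with ij have lt: "Suc i < j" by simp
      let ?u = "adj j \<circ> (adj i \<circ> w)"
      have u: "?u permutes {..<N}" by (rule permutes_compose[OF wi adj_permutes[OF j(1)]])
      from red[OF this] obtain ks where ks: "reduced_word N ?u ks" by blast
      have comm_adj: "adj j \<circ> (adj i \<circ> w) = adj i \<circ> (adj j \<circ> w)"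
        using lt by (auto simp: fun_eq_iff Transposition.transpose_def)
      have 1: "reduced_word N (adj i \<circ> w) (j # ks)"
        using j(2) lt by (intro reduced_word_ConsI[OF wi j(1) _ ks]) (simp add: inv_adj_comp[OF w])
      have 2: "reduced_word N (adj j \<circ> w) (i # ks)"
        using i(2) lt ks by (intro reduced_word_ConsI[OF wj i(1)]) (simp_all add: inv_adj_comp[OF w] comm_adj)
      have "foldr T is' x = foldr T (j # ks) x" "foldr T js' x = foldr T (i # ks) x"
        using IH[OF _ i(3) 1] IH[OF _ j(3) 2] l by simp_all
      then show ?thesis using comm[OF lt j(1) in_X[OF ks]] by simp
    next
      case True
      let ?u = "adj i \<circ> (adj j \<circ> (adj i \<circ> w))"
      have wji: "adj j \<circ> (adj i \<circ> w) permutes {..<N}" by (rule permutes_compose[OF wi adj_permutes[OF j(1)]])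
      have wij: "adj i \<circ> (adj j \<circ> w) permutes {..<N}" by (rule permutes_compose[OF wj adj_permutes[OF i(1)]])
      have u: "?u permutes {..<N}" by (rule permutes_compose[OF wji adj_permutes[OF i(1)]])
      from red[OF this] obtain ks where ks: "reduced_word N ?u ks" by blast
      have braid_adj: "?u = adj j \<circ> (adj i \<circ> (adj j \<circ> w))"
        using True by (auto simp: fun_eq_iff Transposition.transpose_def)
      \<comment> \<open>Two adjacent descents order all three values, so the longest element of the
        group generated by s_i and s_(i+1) can be stripped off w.\<close>
      have d: "inv w (Suc (Suc i)) < inv w (Suc i)" "inv w (Suc i) < inv w i"
        using i(2) j(2) True by simp_all
      have 1: "reduced_word N (adj i \<circ> w) (j # i # ks)"
        using d True
        by (intro reduced_word_ConsI[OF wi j(1)] reduced_word_ConsI[OF wji i(1)] ks)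
           (simp_all add: inv_adj_comp[OF w] inv_adj_comp[OF wi] Transposition.transpose_def)
      have 2: "reduced_word N (adj j \<circ> w) (i # j # ks)"
        using d True ks
        by (intro reduced_word_ConsI[OF wj i(1)] reduced_word_ConsI[OF wij j(1)])
           (simp_all add: inv_adj_comp[OF w] inv_adj_comp[OF wj[unfolded True]]
             braid_adj[unfolded True, symmetric] Transposition.transpose_def)
      have "foldr T is' x = foldr T (j # i # ks) x" "foldr T js' x = foldr T (i # j # ks) x"
        using IH[OF _ i(3) 1] IH[OF _ j(3) 2] l by simp_all
      then show ?thesis using braid[OF _ in_X[OF ks], of i] j(1) True by simp
    qed
  qed
  show ?case
  proof (cases "is")
    case Nil
    then show ?thesis using len by simp
  next
    case (Cons i is')
    then obtain j js' where js: "js = j # js'" using len by (cases js) auto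
    note ri = less.prems(1)[unfolded Cons] and rj = less.prems(2)[unfolded js]
    note IH = less.hyps[unfolded Cons]
    consider "i = j" | "i < j" | "j < i" by linarith
    then show ?thesis
    proof cases
      case 1
      have "foldr T is' x = foldr T js' x"
        using reduced_word_ConsD(3)[OF ri] reduced_word_ConsD(3)[OF rj] 1 by (intro IH) auto
      then show ?thesis using 1 Cons js by simp
    next
      case 2
      from step[OF this ri rj IH] show ?thesis by (simp add: Cons js)
    next
      case 3
      have "length (j # js') = length (i # is')" using len Cons js by simp
      from step[OF 3 rj ri IH[folded this]] show ?thesis by (simp add: Cons js)
    qed
  qed
qed

section \<open>Coset representatives for $S_N$ in $S_{N+1}$\<close>

text \<open>\<open>word_perm [i..<N]\<close> is the cycle moving \<open>N\<close> to \<open>i\<close>.\<close>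

lemma word_perm_upt_last: "i \<le> N \<Longrightarrow> word_perm [i..<N] N = i"
  by (induction i rule: inc_induct) (simp_all add: upt_rec[of _ N] Transposition.transpose_def)

lemma word_perm_upt_permutes: "word_perm [i..<N] permutes {..<Suc N}"
  by (rule word_perm_permutes) simp

lemma permutes_lessThan_Suc: "w permutes {..<N} \<Longrightarrow> w permutes {..<Suc N}"
  by (rule permutes_subset) auto

lemma perm_length_Suc:
  assumes "w permutes {..<N}"
  shows "perm_length (Suc N) w = perm_length N w"
proof -
  have "w j < N" if "j < N" for j using permutes_in_image[OF assms, of j] that by simp
  then have "inversions (Suc N) w = inversions N w"
    using permutes_not_in[OF assms, of N] by (fastforce simp: inversions_def less_Suc_eq)
  then show ?thesis by (simp add: perm_length_eq)
qed

text \<open>The product built so far sends N to i + 1, so its inverse takes the maximal value N at i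
  + 1. Hence i is a left ascent, and prefixing it keeps the word reduced.\<close>

lemma reduced_word_coset:
  assumes "reduced_word N w is" "i \<le> N"
  shows "reduced_word (Suc N) (word_perm [i..<N] \<circ> w) ([i..<N] @ is)"
  using assms(2)
proof (induction i rule: inc_induct)
  case base
  show ?case using assms perm_length_Suc[OF reduced_word_permutes[OF assms(1)]]
    by (auto simp: reduced_word_alt)
next
  case (step i)
  let ?c = "word_perm [Suc i..<N]"
  have w: "w permutes {..<N}" by (rule reduced_word_permutes[OF assms(1)])
  have c: "?c permutes {..<Suc N}" by (rule word_perm_upt_permutes)
  have cw: "?c \<circ> w permutes {..<Suc N}" by (rule permutes_compose[OF permutes_lessThan_Suc[OF w] c])
  have upt: "[i..<N] = i # [Suc i..<N]" using step by (simp add: upt_rec)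
  have "(?c \<circ> w) N = Suc i"
    using word_perm_upt_last[of "Suc i" N] step permutes_not_in[OF w, of N] by simp
  then have 1: "inv (?c \<circ> w) (Suc i) = N" by (simp add: permutes_inv_eq[OF cw])
  have "inv (?c \<circ> w) i \<noteq> inv (?c \<circ> w) (Suc i)" by (rule inv_neq[OF cw]) simp
  moreover have "inv (?c \<circ> w) i < Suc N"
    using permutes_in_image[OF permutes_inv[OF cw], of i] step by simp
  ultimately have "inv (?c \<circ> w) i < inv (?c \<circ> w) (Suc i)" using 1 by simp
  from reduced_word_Cons_up[OF step.IH _ this] step(2) show ?case
    unfolding upt word_perm_simps append_Cons comp_assoc by (simp del: o_apply)
qed

text \<open>The coset of u is determined by i = u N; undoing the cycle that moves N to i leaves a
  permutation fixing N.\<close>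

lemma sum_permutes_Suc:
  fixes f :: "(nat \<Rightarrow> nat) \<Rightarrow> 'b::comm_monoid_add"
  shows "(\<Sum>u | u permutes {..<Suc N}. f u) =
    (\<Sum>i\<le>N. \<Sum>w | w permutes {..<N}. f (word_perm [i..<N] \<circ> w))"
proof -
  let ?g = "\<lambda>(i, w). word_perm [i..<N] \<circ> w"
  have last: "(word_perm [i..<N] \<circ> w) N = i" if "i \<le> N" "w permutes {..<N}" for i w
    using word_perm_upt_last[OF that(1)] permutes_not_in[OF that(2), of N] by simp
  have "bij_betw ?g ({..N} \<times> {w. w permutes {..<N}}) {u. u permutes {..<Suc N}}"
  proof (rule bij_betwI')
    fix x y assume "x \<in> {..N} \<times> {w. w permutes {..<N}}" "y \<in> {..N} \<times> {w. w permutes {..<N}}"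
    then obtain i w j w' where xy: "x = (i, w)" "y = (j, w')" "i \<le> N" "j \<le> N"
      "w permutes {..<N}" "w' permutes {..<N}" by auto
    have "i = j \<and> w = w'" if eq: "word_perm [i..<N] \<circ> w = word_perm [j..<N] \<circ> w'"
    proof -
      have "i = j" using last[of i w] last[of j w'] xy eq by metis
      moreover have "w = w'"
        using eq \<open>i = j\<close> permutes_inj[OF word_perm_upt_permutes[of i N]] by (simp add: fun.inj_map_strong fun_eq_iff inj_eq)
      ultimately show ?thesis ..
    qed
    then show "(?g x = ?g y) = (x = y)" using xy by auto
  next
    fix x assume "x \<in> {..N} \<times> {w. w permutes {..<N}}"
    then show "?g x \<in> {u. u permutes {..<Suc N}}"
      by (auto intro: permutes_compose[OF permutes_lessThan_Suc word_perm_upt_permutes])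
  next
    fix u assume "u \<in> {u. u permutes {..<Suc N}}"
    then have u: "u permutes {..<Suc N}" by simp
    define i where "i = u N"
    have i: "i \<le> N" using permutes_in_image[OF u, of N] by (simp add: i_def)
    let ?c = "word_perm [i..<N]"
    have c: "?c permutes {..<Suc N}" by (rule word_perm_upt_permutes)
    define w where "w = inv ?c \<circ> u"
    have w: "w permutes {..<Suc N}" unfolding w_def by (rule permutes_compose[OF u permutes_inv[OF c]])
    have "w N = N" using word_perm_upt_last[OF i] by (simp add: w_def i_def[symmetric] permutes_inv_eq[OF c])
    then have "w permutes {..<N}"
      by (intro permutes_superset[OF w]) (auto simp: less_Suc_eq)
    moreover have "u = ?c \<circ> w" unfolding w_def by (simp add: comp_assoc[symmetric] permutes_inv_o[OF c])
    ultimately show "\<exists>x\<in>{..N} \<times> {w. w permutes {..<N}}. u = ?g x" using i by force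
  qed
  from sum.reindex_bij_betw[OF this, of f, symmetric] show ?thesis
    by (simp add: sum.cartesian_product case_prod_unfold)
qed

lemma perm_length_coset:
  assumes "w permutes {..<N}" "i \<le> N"
  shows "perm_length (Suc N) (word_perm [i..<N] \<circ> w) = N - i + perm_length N w"
proof -
  from reduced_word_exists[OF assms(1)] obtain "is" where r: "reduced_word N w is" ..
  from r have "length is = perm_length N w" by (simp add: reduced_word_alt)
  moreover from reduced_word_coset[OF r assms(2)]
  have "length ([i..<N] @ is) = perm_length (Suc N) (word_perm [i..<N] \<circ> w)"
    by (simp add: reduced_word_alt)
  ultimately show ?thesis by simp
qed

text \<open>The Poincare polynomial of the symmetric group; the coset representatives, of lengths 0
  to N, contribute the factor added in each step.\<close>

lemma sum_power_perm_length:
  fixes q :: "'a::comm_ring_1"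
  shows "(\<Sum>w | w permutes {..<N}. q ^ perm_length N w) = (\<Prod>i=1..N. \<Sum>j<i. q ^ j)"
proof (induction N)
  case 0
  show ?case by (simp add: perm_length_def)
next
  case (Suc N)
  have "(\<Sum>u | u permutes {..<Suc N}. q ^ perm_length (Suc N) u) =
    (\<Sum>i\<le>N. \<Sum>w | w permutes {..<N}. q ^ (N - i) * q ^ perm_length N w)"
    unfolding sum_permutes_Suc
    by (intro sum.cong refl) (simp only: mem_Collect_eq atMost_iff perm_length_coset power_add)
  also have "\<dots> = (\<Sum>i\<le>N. q ^ (N - i)) * (\<Prod>i=1..N. \<Sum>j<i. q ^ j)"
    by (simp add: sum_distrib_left[symmetric] sum_distrib_right Suc)
  also have "(\<Sum>i\<le>N. q ^ (N - i)) = (\<Sum>j<Suc N. q ^ j)"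
    unfolding lessThan_Suc_atMost by (rule sum.nat_diff_reindex[of "\<lambda>j. q ^ j" "Suc N", simplified lessThan_Suc_atMost, simplified])
  finally show ?case by (simp add: mult.commute)
qed

section \<open>The antisymmetrizer\<close>

locale qwedge =
  fixes n :: nat and v :: complex
  assumes n: "n \<ge> 1" and v0: "v \<noteq> 0" and v_nroot: "\<forall>r::nat. r > 0 \<longrightarrow> v ^ r \<noteq> 1"
begin

text \<open>The eigenvalue of the generators on the wedge power; the other one is \<open>v\<close>.\<close>

definition \<kappa> :: complex where "\<kappa> = - inverse v"

abbreviation "T \<equiv> T_op n v"

lemma \<kappa>_nonzero: "\<kappa> \<noteq> 0"
  using v0 by (simp add: \<kappa>_def)

lemma \<kappa>_quadratic: "1 + \<kappa> * (v - inverse v) = \<kappa> * \<kappa>"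
  using v0 by (simp add: \<kappa>_def field_simps)

lemma \<kappa>_powi: "(- v) powi (- int l) = \<kappa> ^ l"
proof -
  have "\<kappa> = inverse (- v)" by (simp add: \<kappa>_def)
  then show ?thesis by (simp add: power_int_minus power_inverse del: inverse_minus_eq)
qed

lemma \<kappa>_square_power: "i > 0 \<Longrightarrow> (\<kappa> * \<kappa>) ^ i \<noteq> 1"
proof
  assume i: "i > 0" and eq: "(\<kappa> * \<kappa>) ^ i = 1"
  have "(\<kappa> * \<kappa>) ^ i * v ^ (2 * i) = (\<kappa> * \<kappa> * v ^ 2) ^ i"
    by (simp add: power_mult power_mult_distrib)
  also have "\<kappa> * \<kappa> * v ^ 2 = 1" using v0 by (simp add: \<kappa>_def power2_eq_square field_simps)
  finally show False using v_nroot i eq by simp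
qed

text \<open>Since v^-2 = \<kappa>^2, the quantum factorial becomes the Poincare polynomial at
  \<kappa>^2, which is the normalization that makes the antisymmetrizer idempotent.\<close>

lemma qint_minus_eq_sum: "qint_minus v i = (\<Sum>j<i. (\<kappa> * \<kappa>) ^ j)"
proof -
  have "v powi (- 2 * int j) = (\<kappa> * \<kappa>) ^ j" for j
  proof -
    have "v powi (- 2 * int j) = (v powi (- 2)) ^ j"
      by (simp only: power_int_mult power_int_of_nat)
    also have "v powi (- 2) = \<kappa> * \<kappa>"
      by (simp add: \<kappa>_def power_int_minus power2_eq_square)
    finally show ?thesis .
  qed
  note this[of i] this[of 1]
  then show ?thesis
    using geometric_sum[of "\<kappa> * \<kappa>" i] \<kappa>_square_power[of 1] by (simp add: qint_minus_def)
qed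

lemma qint_minus_nonzero: "i > 0 \<Longrightarrow> qint_minus v i \<noteq> 0"
proof -
  assume "i > 0"
  have "qint_minus v i = ((\<kappa> * \<kappa>) ^ i - 1) / (\<kappa> * \<kappa> - 1)"
    unfolding qint_minus_eq_sum using \<kappa>_square_power[of 1] by (intro geometric_sum) simp
  then show ?thesis using \<kappa>_square_power[of 1] \<kappa>_square_power[of i] \<open>i > 0\<close> by simp
qed

lemma qfact_minus_nonzero: "qfact_minus v N \<noteq> 0"
  unfolding qfact_minus_def using qint_minus_nonzero by auto

lemma qfact_minus_eq_sum: "(\<Sum>w | w permutes {..<N}. (\<kappa> * \<kappa>) ^ perm_length N w) = qfact_minus v N"
  unfolding sum_power_perm_length qfact_minus_def qint_minus_eq_sum ..

definition T_w :: "nat \<Rightarrow> (nat \<Rightarrow> nat) \<Rightarrow> tens \<Rightarrow> tens" where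
  "T_w N w = foldr T (SOME is. reduced_word N w is)"

lemma tlin_foldr_T: "tlin (foldr T is)"
proof (induction "is")
  case (Cons i "is")
  have "tlin (\<lambda>x. T i (foldr T is x))" by (rule tlin_compose[OF tlin_T_op Cons])
  then show ?case by (simp add: comp_def)
qed (simp add: id_def tlin_ident)

lemma tlin_T_w: "tlin (T_w N w)"
  unfolding T_w_def by (rule tlin_foldr_T)

lemma foldr_T_in_ts [simp]: "x \<in> tensor_space N \<Longrightarrow> foldr T is x \<in> tensor_space N"
  by (induction "is") auto

lemma T_w_in_ts [simp]: "x \<in> tensor_space N \<Longrightarrow> T_w N w x \<in> tensor_space N"
  by (simp add: T_w_def)

lemma T_w_eq_foldr:
  assumes "reduced_word N w is" "x \<in> tensor_space N"
  shows "T_w N w x = foldr T is x"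
  unfolding T_w_def
  by (rule foldr_reduced_word_unique[where X = "tensor_space N" and N = N])
     (use assms T_op_commute[OF n] T_op_braid[OF n v0] in \<open>auto intro: someI\<close>)

lemma T_perm_eq:
  assumes "w permutes {..<N}" "x \<in> tensor_space N"
  shows "T_perm n v N w x = T_w N w x"
proof -
  have "\<forall>i\<in>set is. Suc i < N \<Longrightarrow> foldr (T_gen n v N) is x = foldr T is x" for "is"
    using assms(2) by (induction "is") (simp_all add: T_gen_eq_T_op[OF n])
  moreover have "reduced_word N w (SOME is. reduced_word N w is)"
    using reduced_word_exists[OF assms(1)] by (rule someI_ex)
  ultimately show ?thesis by (simp add: T_perm_def T_w_def reduced_word_alt)
qed

lemma T_w_adj_left:
  assumes "w permutes {..<N}" "Suc i < N" "inv w i < inv w (Suc i)" "x \<in> tensor_space N"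
  shows "T_w N (adj i \<circ> w) x = T i (T_w N w x)"
proof -
  obtain "is" where r: "reduced_word N w is" using reduced_word_exists[OF assms(1)] ..
  show ?thesis
    using T_w_eq_foldr[OF r assms(4)] T_w_eq_foldr[OF reduced_word_Cons_up[OF r assms(2,3)] assms(4)] by simp
qed

lemma T_w_adj_right:
  assumes "w permutes {..<N}" "Suc i < N" "w i < w (Suc i)" "x \<in> tensor_space N"
  shows "T_w N (w \<circ> adj i) x = T_w N w (T i x)"
proof -
  obtain "is" where r: "reduced_word N w is" using reduced_word_exists[OF assms(1)] ..
  show ?thesis
    using T_w_eq_foldr[OF r, of "T i x"] T_w_eq_foldr[OF reduced_word_snoc[OF r assms(2,3)] assms(4)] assms(4)
    by simp
qed

lemma foldr_T_eigen:
  assumes "\<forall>i\<in>set is. T i x = scale \<kappa> x"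
  shows "foldr T is x = scale (\<kappa> ^ length is) x"
  using assms by (induction "is") (simp_all add: T_op_lin mult.commute)

lemma T_w_eigen:
  assumes "\<And>i. Suc i < N \<Longrightarrow> T i x = scale \<kappa> x" "w permutes {..<N}" "x \<in> tensor_space N"
  shows "T_w N w x = scale (\<kappa> ^ perm_length N w) x"
proof -
  obtain "is" where r: "reduced_word N w is" using reduced_word_exists[OF assms(2)] ..
  then show ?thesis
    using T_w_eq_foldr[OF r assms(3)] foldr_T_eigen[of "is" x] assms(1) by (simp add: reduced_word_alt)
qed

definition S_sum :: "nat \<Rightarrow> tens \<Rightarrow> tens" where
  "S_sum N x = (\<Sum>w | w permutes {..<N}. scale (\<kappa> ^ perm_length N w) (T_w N w x))"

definition S_op :: "nat \<Rightarrow> tens \<Rightarrow> tens" where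
  "S_op N x = scale (1 / qfact_minus v N) (S_sum N x)"

lemma tlin_S_sum: "tlin (S_sum N)"
  unfolding S_sum_def by (intro tlin_sum_fun tlin_scale_fun tlin_T_w)

lemma tlin_S_op: "tlin (S_op N)"
  unfolding S_op_def by (intro tlin_scale_fun tlin_S_sum)

lemmas S_lin = tlin_simps[OF tlin_S_op] tlin_simps[OF tlin_S_sum] tens2.linear_sum[OF tlin_S_op]

lemma S_op_in_ts [simp]: "x \<in> tensor_space N \<Longrightarrow> S_op N x \<in> tensor_space N"
  unfolding S_op_def S_sum_def by (intro ts_scale ts_sum T_w_in_ts)

lemma S_minus_eq: "x \<in> tensor_space N \<Longrightarrow> S_minus n v N x = S_op N x"
  unfolding S_minus_def S_op_def S_sum_def \<kappa>_powi
  by (intro arg_cong[where f = "scale _"] sum.cong) (simp_all add: T_perm_eq)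

text \<open>Used to group a sum over the symmetric group into pairs w, s_i w or w, w s_i, with P
  selecting the shorter element.\<close>

lemma sum_permutes_pair:
  fixes f :: "(nat \<Rightarrow> nat) \<Rightarrow> tens"
  assumes inv: "\<And>w. g (g w) = w" and perm: "\<And>w. w permutes {..<N} \<Longrightarrow> g w permutes {..<N}"
    and P: "\<And>w. w permutes {..<N} \<Longrightarrow> P (g w) \<longleftrightarrow> \<not> P w"
  shows "(\<Sum>w | w permutes {..<N}. f w) = (\<Sum>w | w permutes {..<N} \<and> P w. f w + f (g w))"
proof -
  have fin: "finite {w. w permutes {..<N} \<and> Q w}" for Q
    by (rule finite_subset[OF _ finite_permutations[of "{..<N}"]]) auto
  have eq: "{w. w permutes {..<N}} = {w. w permutes {..<N} \<and> P w} \<union> {w. w permutes {..<N} \<and> \<not> P w}" by auto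
  have "(\<Sum>w | w permutes {..<N}. f w) =
      (\<Sum>w | w permutes {..<N} \<and> P w. f w) + (\<Sum>w | w permutes {..<N} \<and> \<not> P w. f w)"
    unfolding eq by (intro sum.union_disjoint fin) auto
  also have "(\<Sum>w | w permutes {..<N} \<and> \<not> P w. f w) = (\<Sum>w | w permutes {..<N} \<and> P w. f (g w))"
    by (rule sum.reindex_bij_witness[of _ g g]) (use assms in auto)
  finally show ?thesis by (simp add: sum.distrib)
qed

text \<open>The pair w, s_i w contributes \<kappa>^l (1 + \<kappa> T_i) T_w x, where l is the length
  of w. By the quadratic relation and \<open>\<kappa>_quadratic\<close>, T_i (1 + \<kappa> T_i) =
  \<kappa> (1 + \<kappa> T_i).\<close>

lemma T_S_op:
  assumes i: "Suc i < N" and x: "x \<in> tensor_space N"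
  shows "T i (S_op N x) = scale \<kappa> (S_op N x)"
proof -
  let ?P = "\<lambda>w. inv w i < inv w (Suc i)"
  let ?f = "\<lambda>w. scale (\<kappa> ^ perm_length N w) (T_w N w x)"
  have S: "S_sum N x = (\<Sum>w | w permutes {..<N} \<and> ?P w. ?f w + ?f (adj i \<circ> w))"
    unfolding S_sum_def
  proof (rule sum_permutes_pair)
    fix w :: "nat \<Rightarrow> nat" assume w: "w permutes {..<N}"
    show "adj i \<circ> w permutes {..<N}" by (rule permutes_compose[OF w adj_permutes[OF i]])
    show "?P (adj i \<circ> w) \<longleftrightarrow> \<not> ?P w"
      using inv_neq[OF w, of i "Suc i"] by (auto simp: inv_adj_comp[OF w])
  qed simp
  have "T i (S_sum N x) = scale \<kappa> (S_sum N x)"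
    unfolding S tens2.linear_sum[OF tlin_T_op] tens.scale_sum_right
  proof (rule sum.cong[OF refl])
    fix w assume "w \<in> {w. w permutes {..<N} \<and> ?P w}"
    then have w: "w permutes {..<N}" "?P w" by auto
    let ?y = "T_w N w x" and ?l = "perm_length N w"
    have q: "T i (T i ?y) = ?y + scale (v - inverse v) (T i ?y)"
      using T_op_quadratic[OF n i _ v0] x by simp
    have "\<kappa> ^ ?l + \<kappa> * \<kappa> ^ ?l * (v - inverse v) = \<kappa> ^ ?l * (1 + \<kappa> * (v - inverse v))"
      by (simp add: algebra_simps)
    then have e: "\<kappa> ^ ?l + \<kappa> * \<kappa> ^ ?l * (v - inverse v) = \<kappa> * (\<kappa> * \<kappa> ^ ?l)"
      by (simp add: \<kappa>_quadratic)
    have "T i (?f w + ?f (adj i \<circ> w)) =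
        scale (\<kappa> ^ ?l) (T i ?y) + scale (\<kappa> * \<kappa> ^ ?l) (?y + scale (v - inverse v) (T i ?y))"
      by (simp add: perm_length_adj_left[OF w(1) i w(2)] T_w_adj_left[OF w(1) i w(2) x] T_op_lin q del: tens.scale_scale)
    also have "\<dots> = scale (\<kappa> * \<kappa> ^ ?l) ?y + scale (\<kappa> ^ ?l + \<kappa> * \<kappa> ^ ?l * (v - inverse v)) (T i ?y)"
      by (simp add: tens.scale_right_distrib tens.scale_left_distrib)
    also have "\<dots> = scale \<kappa> (?f w + ?f (adj i \<circ> w))"
      unfolding e
      by (simp add: perm_length_adj_left[OF w(1) i w(2)] T_w_adj_left[OF w(1) i w(2) x] tens.scale_right_distrib)
    finally show "T i (?f w + ?f (adj i \<circ> w)) = scale \<kappa> (?f w + ?f (adj i \<circ> w))" .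
  qed
  then show ?thesis by (simp add: S_op_def T_op_lin tens.scale_left_commute)
qed

text \<open>The mirror image of \<open>T_S_op\<close>, with the pairs w, w s_i and the factor 1 +
  \<kappa> T_i on the right.\<close>

lemma S_op_T:
  assumes i: "Suc i < N" and x: "x \<in> tensor_space N"
  shows "S_op N (T i x) = scale \<kappa> (S_op N x)"
proof -
  let ?P = "\<lambda>w. w i < w (Suc i)"
  have S: "S_sum N y = (\<Sum>w | w permutes {..<N} \<and> ?P w. scale (\<kappa> ^ perm_length N w) (T_w N w y) +
       scale (\<kappa> ^ perm_length N (w \<circ> adj i)) (T_w N (w \<circ> adj i) y))" for y
    unfolding S_sum_def
  proof (rule sum_permutes_pair)
    fix w :: "nat \<Rightarrow> nat" assume w: "w permutes {..<N}"
    show "w \<circ> adj i permutes {..<N}" by (rule permutes_compose[OF adj_permutes[OF i] w])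
    have "w i \<noteq> w (Suc i)" using permutes_inj[OF w] by (simp add: inj_eq)
    then show "?P (w \<circ> adj i) \<longleftrightarrow> \<not> ?P w" by auto
  qed (simp add: comp_assoc)
  have "S_sum N (T i x) = scale \<kappa> (S_sum N x)"
    unfolding S tens.scale_sum_right
  proof (rule sum.cong[OF refl])
    fix w assume "w \<in> {w. w permutes {..<N} \<and> ?P w}"
    then have w: "w permutes {..<N}" "?P w" by auto
    let ?l = "perm_length N w"
    have Tx: "T i x \<in> tensor_space N" using x by simp
    have q: "T_w N w (T i (T i x)) = T_w N w x + scale (v - inverse v) (T_w N w (T i x))"
      using T_op_quadratic[OF n i x v0] by (simp add: tlin_simps[OF tlin_T_w])
    have "\<kappa> ^ ?l + \<kappa> * \<kappa> ^ ?l * (v - inverse v) = \<kappa> ^ ?l * (1 + \<kappa> * (v - inverse v))"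
      by (simp add: algebra_simps)
    then have e: "\<kappa> ^ ?l + \<kappa> * \<kappa> ^ ?l * (v - inverse v) = \<kappa> * (\<kappa> * \<kappa> ^ ?l)"
      by (simp add: \<kappa>_quadratic)
    have "scale (\<kappa> ^ ?l) (T_w N w (T i x)) + scale (\<kappa> ^ perm_length N (w \<circ> adj i)) (T_w N (w \<circ> adj i) (T i x))
      = scale (\<kappa> * \<kappa> ^ ?l) (T_w N w x) + scale (\<kappa> ^ ?l + \<kappa> * \<kappa> ^ ?l * (v - inverse v)) (T_w N w (T i x))"
      by (simp add: perm_length_adj_right[OF w(1) i w(2)] T_w_adj_right[OF w(1) i w(2) Tx] q
          tens.scale_right_distrib tens.scale_left_distrib)
    also have "\<dots> = scale \<kappa> (scale (\<kappa> ^ ?l) (T_w N w x) +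
        scale (\<kappa> ^ perm_length N (w \<circ> adj i)) (T_w N (w \<circ> adj i) x))"
      unfolding e
      by (simp add: perm_length_adj_right[OF w(1) i w(2)] T_w_adj_right[OF w(1) i w(2) x] tens.scale_right_distrib)
    finally show "scale (\<kappa> ^ ?l) (T_w N w (T i x)) + scale (\<kappa> ^ perm_length N (w \<circ> adj i)) (T_w N (w \<circ> adj i) (T i x))
      = scale \<kappa> (scale (\<kappa> ^ ?l) (T_w N w x) +
        scale (\<kappa> ^ perm_length N (w \<circ> adj i)) (T_w N (w \<circ> adj i) x))" .
  qed
  then show ?thesis by (simp add: S_op_def tens.scale_left_commute)
qed

section \<open>Wedge powers\<close>

text \<open>An intrinsic description of the wedge power: the antisymmetrizer maps into this space
  and is the identity on it. Unlike the image description, it passes directly to slices.\<close>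

definition eigenspace :: "nat \<Rightarrow> tens set" where
  "eigenspace N = {x \<in> tensor_space N. \<forall>i. Suc i < N \<longrightarrow> T i x = scale \<kappa> x}"

lemma T_eigenspace: "x \<in> eigenspace N \<Longrightarrow> Suc i < N \<Longrightarrow> T i x = scale \<kappa> x"
  by (simp add: eigenspace_def)

lemma subspace_eigenspace: "tens.subspace (eigenspace N)"
  by (rule tens.subspaceI)
     (auto simp: eigenspace_def T_op_lin tens.scale_right_distrib tens.scale_left_commute)

lemma S_op_in_eigenspace: "x \<in> tensor_space N \<Longrightarrow> S_op N x \<in> eigenspace N"
  by (simp add: eigenspace_def T_S_op)

lemma eigenspace_in_ts [simp]: "x \<in> eigenspace N \<Longrightarrow> x \<in> tensor_space N"
  by (simp add: eigenspace_def)

lemma S_op_eigenspace: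
  assumes "x \<in> eigenspace N"
  shows "S_op N x = x"
proof -
  have "S_sum N x = (\<Sum>w | w permutes {..<N}. scale ((\<kappa> * \<kappa>) ^ perm_length N w) x)"
    unfolding S_sum_def
    by (intro sum.cong refl) (use assms in \<open>simp add: T_w_eigen[OF T_eigenspace] power_mult_distrib\<close>)
  also have "\<dots> = scale (qfact_minus v N) x"
    by (simp add: qfact_minus_eq_sum tens.scale_sum_left[symmetric])
  finally show ?thesis using qfact_minus_nonzero by (simp add: S_op_def)
qed

lemma Wedge_eq: "Wedge n v N = eigenspace N"
proof
  show "Wedge n v N \<subseteq> eigenspace N" by (auto simp: Wedge_def S_minus_eq S_op_in_eigenspace)
  show "eigenspace N \<subseteq> Wedge n v N"
  proof
    fix x assume "x \<in> eigenspace N"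
    then have "x = S_minus n v N x" "x \<in> tensor_space N" by (simp_all add: S_minus_eq S_op_eigenspace)
    then show "x \<in> Wedge n v N" unfolding Wedge_def by (rule image_eqI)
  qed
qed

text \<open>A version of \<open>wedge_e\<close> that is linear on all tensors; the two agree on the
  wedge power.\<close>

definition wdg :: "nat \<Rightarrow> int \<Rightarrow> tens \<Rightarrow> tens" where
  "wdg N k x = S_op (Suc N) (app k x)"

lemma tlin_wdg: "tlin (wdg N k)"
  unfolding wdg_def by (rule tlin_compose[OF tlin_S_op tlin_app])

lemmas wdg_lin = tlin_simps[OF tlin_wdg] tens2.linear_sum[OF tlin_wdg]

lemma wdg_in_eigenspace: "x \<in> tensor_space N \<Longrightarrow> wdg N k x \<in> eigenspace (Suc N)"
  unfolding wdg_def by (intro S_op_in_eigenspace app_in_ts)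

lemma wdg_foldr_T:
  assumes "x \<in> tensor_space N" "\<forall>i\<in>set is. Suc i < N"
  shows "wdg N k (foldr T is x) = scale (\<kappa> ^ length is) (wdg N k x)"
  using assms(2)
proof (induction "is")
  case (Cons i "is")
  then have i: "Suc i < N" by simp
  have "wdg N k (T i (foldr T is x)) = S_op (Suc N) (T i (app k (foldr T is x)))"
    using T_op_app[OF n v0 i, of "foldr T is x"] assms(1) by (simp add: wdg_def)
  also have "\<dots> = scale \<kappa> (wdg N k (foldr T is x))"
    using assms(1) i by (simp add: S_op_T wdg_def)
  finally show ?case using Cons by simp
qed simp

text \<open>A generator on the first N factors commutes with appending a factor and is absorbed by
  the larger antisymmetrizer as \<kappa>. This makes the wedge product independent of the
  representative.\<close>

lemma wdg_S_op:
  assumes "x \<in> tensor_space N"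
  shows "wdg N k (S_op N x) = wdg N k x"
proof -
  have "wdg N k (T_w N w x) = scale (\<kappa> ^ perm_length N w) (wdg N k x)" if w: "w permutes {..<N}" for w
  proof -
    obtain "is" where r: "reduced_word N w is" using reduced_word_exists[OF w] ..
    then show ?thesis
      using T_w_eq_foldr[OF r assms] wdg_foldr_T[OF assms, of "is"] by (simp add: reduced_word_alt)
  qed
  then have "wdg N k (S_sum N x) = (\<Sum>w | w permutes {..<N}. scale ((\<kappa> * \<kappa>) ^ perm_length N w) (wdg N k x))"
    unfolding S_sum_def wdg_lin by (intro sum.cong refl) (simp add: power_mult_distrib)
  also have "\<dots> = scale (qfact_minus v N) (wdg N k x)"
    by (simp add: qfact_minus_eq_sum tens.scale_sum_left[symmetric])
  finally show ?thesis using qfact_minus_nonzero by (simp add: S_op_def wdg_lin)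
qed

lemma wedge_e_eq:
  assumes "w \<in> eigenspace N"
  shows "wedge_e n v N k w = wdg N k w"
  unfolding wedge_e_def app_def[symmetric]
proof (rule the_equality)
  show "\<exists>x\<in>tensor_space N. w = S_minus n v N x \<and> wdg N k w = S_minus n v (Suc N) (app k x)"
    by (rule bexI[of _ w]) (use assms in \<open>simp_all add: S_minus_eq S_op_eigenspace wdg_def\<close>)
  fix u assume "\<exists>x\<in>tensor_space N. w = S_minus n v N x \<and> u = S_minus n v (Suc N) (app k x)"
  then obtain x where "x \<in> tensor_space N" "w = S_op N x" "u = wdg N k x"
    by (auto simp: S_minus_eq wdg_def)
  then show "u = wdg N k w" by (simp add: wdg_S_op)
qed

text \<open>Split the antisymmetrizer on N + 1 factors along the cosets. On x (x) e_k the subgroup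
  part is a scalar that cancels the factorial of N, leaving one quantum integer; this is where the
  factor in the normalization of \<Psi>* originates.\<close>

lemma wdg_coset_expansion:
  assumes "x \<in> eigenspace N"
  shows "scale (qint_minus v (Suc N)) (wdg N k x) =
    (\<Sum>i\<le>N. scale (\<kappa> ^ (N - i)) (foldr T [i..<N] (app k x)))"
proof -
  have ts: "app k x \<in> tensor_space (Suc N)" using assms by simp
  have e: "T i (app k x) = scale \<kappa> (app k x)" if "Suc i < N" for i
    using T_op_app[OF n v0 that] T_eigenspace[OF assms that] assms by (simp add: app_lin)
  have t: "scale (\<kappa> ^ perm_length (Suc N) (word_perm [i..<N] \<circ> w)) (T_w (Suc N) (word_perm [i..<N] \<circ> w) (app k x))
     = scale ((\<kappa> * \<kappa>) ^ perm_length N w) (scale (\<kappa> ^ (N - i)) (foldr T [i..<N] (app k x)))"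
    if i: "i \<le> N" and w: "w permutes {..<N}" for i w
  proof -
    obtain "is" where r: "reduced_word N w is" using reduced_word_exists[OF w] ..
    have "foldr T is (app k x) = scale (\<kappa> ^ perm_length N w) (app k x)"
      using foldr_T_eigen[of "is" "app k x"] e r by (simp add: reduced_word_alt)
    then have "T_w (Suc N) (word_perm [i..<N] \<circ> w) (app k x)
       = scale (\<kappa> ^ perm_length N w) (foldr T [i..<N] (app k x))"
      using T_w_eq_foldr[OF reduced_word_coset[OF r i] ts] by (simp add: tlin_simps[OF tlin_foldr_T])
    then show ?thesis
      unfolding perm_length_coset[OF w i] by (simp add: power_add power_mult_distrib mult.commute mult.left_commute)
  qed
  have "S_sum (Suc N) (app k x) = (\<Sum>i\<le>N. \<Sum>w | w permutes {..<N}. scale ((\<kappa> * \<kappa>) ^ perm_length N w)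
      (scale (\<kappa> ^ (N - i)) (foldr T [i..<N] (app k x))))"
    unfolding S_sum_def sum_permutes_Suc by (intro sum.cong refl t) auto
  also have "\<dots> = scale (qfact_minus v N) (\<Sum>i\<le>N. scale (\<kappa> ^ (N - i)) (foldr T [i..<N] (app k x)))"
    by (simp only: tens.scale_sum_left[symmetric] qfact_minus_eq_sum tens.scale_sum_right)
  finally have "S_sum (Suc N) (app k x) = scale (qfact_minus v N) (\<Sum>i\<le>N. scale (\<kappa> ^ (N - i)) (foldr T [i..<N] (app k x)))" .
  moreover have "qfact_minus v (Suc N) = qfact_minus v N * qint_minus v (Suc N)"
    by (simp add: qfact_minus_def)
  ultimately show ?thesis
    using qfact_minus_nonzero[of N] qint_minus_nonzero[of "Suc N"]
    by (simp add: wdg_def S_op_def)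
qed


section \<open>Straightening in the wedge powers\<close>

lemma wdg_wdg: "x \<in> tensor_space N \<Longrightarrow> wdg (Suc N) q (wdg N p x) = S_op (Suc (Suc N)) (app q (app p x))"
  using wdg_S_op[of "app p x" "Suc N" q] by (simp add: wdg_def)

text \<open>Antisymmetrize T_N (x (x) e_p (x) e_q) in two ways: the generator is absorbed as
  \<kappa>, or it is first expanded in its triangular form.\<close>

lemma wdg_straighten:
  assumes x: "x \<in> tensor_space N"
  shows "scale \<kappa> (wdg (Suc N) q (wdg N p x)) =
    scale (alpha_coeff n v p q) (wdg (Suc N) p (wdg N q x)) + scale (beta_coeff v p q) (wdg (Suc N) q (wdg N p x))
    + (\<Sum>y\<in>{min p q<..<max p q}. scale (gamma_coeff n v p q y) (wdg (Suc N) (p + q - y) (wdg N y x)))"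
proof -
  have "scale \<kappa> (wdg (Suc N) q (wdg N p x)) = S_op (Suc (Suc N)) (T N (app q (app p x)))"
    using x by (simp add: wdg_wdg S_op_T)
  then show ?thesis
    using x by (simp add: T_op_app_app[OF n v0 x] S_lin wdg_wdg)
qed

lemma v_neq_\<kappa>: "\<kappa> \<noteq> v"
proof
  assume "\<kappa> = v"
  then have "v * v = - 1" using v0 by (simp add: \<kappa>_def field_simps)
  then have "v ^ 4 = 1" by (simp add: power4_eq_xxxx)
  then show False using v_nroot by (metis zero_less_numeral)
qed

lemma wdg_same:
  assumes "x \<in> tensor_space N"
  shows "wdg (Suc N) p (wdg N p x) = 0"
proof -
  have "scale (\<kappa> - v) (wdg (Suc N) p (wdg N p x)) = 0"
    using wdg_straighten[OF assms, of p p] by (simp add: alpha_coeff_def beta_coeff_def tens.scale_left_diff_distrib)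
  then show ?thesis using v_neq_\<kappa> by simp
qed

section \<open>Wedging with runs of consecutive indices\<close>

primrec run :: "nat \<Rightarrow> int \<Rightarrow> tens \<Rightarrow> nat \<Rightarrow> tens" where
  "run N s w 0 = w"
| "run N s w (Suc j) = wdg (N + j) (s + int j) (run N s w j)"

lemma run_in_eigenspace: "w \<in> eigenspace N \<Longrightarrow> run N s w j \<in> eigenspace (N + j)"
  by (induction j) (auto intro: wdg_in_eigenspace)

lemma run_scale: "run N s (scale c w) j = scale c (run N s w j)"
  by (induction j) (simp_all add: wdg_lin)

lemma run_add: "run N s w (i + j) = run (N + i) (s + int i) (run N s w i) j"
  by (induction j) (simp_all add: add.assoc)

lemma phi_eq_run:
  assumes "w \<in> eigenspace N"
  shows "phi n v m (N + j) N w = run N (int N - m) w j"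
proof (induction j)
  case (Suc j)
  then show ?case
    by (simp add: phi_def wedge_e_eq[OF run_in_eigenspace[OF assms]] diff_add_eq)
qed (simp add: phi_def)

text \<open>Straightening the last index of the run against a smaller r puts indices from r up to,
  but excluding, the last one directly behind the shorter run, where they vanish by
  induction.\<close>

lemma wdg_run_eq_0:
  assumes w: "w \<in> eigenspace N" and "s \<le> r" "r < s + int j"
  shows "wdg (N + j) r (run N s w j) = 0"
  using assms(2,3)
proof (induction j arbitrary: r)
  case (Suc j)
  let ?U = "run N s w j" and ?p = "s + int j"
  have U: "?U \<in> tensor_space (N + j)" using run_in_eigenspace[OF w] by simp
  show ?case
  proof (cases "r = ?p")
    case True
    then show ?thesis using wdg_same[OF U] by simp
  next
    case False
    with Suc.prems have r: "s \<le> r" "r < ?p" by simp_all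
    have "scale \<kappa> (wdg (Suc (N + j)) r (wdg (N + j) ?p ?U)) = 0"
      unfolding wdg_straighten[OF U] using r
      by (auto simp: Suc.IH beta_coeff_def wdg_lin intro!: sum.neutral)
    then show ?thesis using \<kappa>_nonzero by simp
  qed
qed simp

lemma \<kappa>_minus: "\<kappa> - (v - inverse v) = - v"
  by (simp add: \<kappa>_def)

text \<open>For p < q the \<open>beta_coeff\<close> term is a multiple of the left side; moving it
  over leaves \<kappa> - (v - v^-1) = -v.\<close>

lemma wdg_straighten_up:
  assumes "x \<in> tensor_space N" "p < q"
  shows "scale (- v) (wdg (Suc N) q (wdg N p x)) = scale (alpha_coeff n v p q) (wdg (Suc N) p (wdg N q x))
    + (\<Sum>y\<in>{p<..<q}. scale (gamma_coeff n v p q y) (wdg (Suc N) (p + q - y) (wdg N y x)))"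
  unfolding \<kappa>_minus[symmetric] tens.scale_left_diff_distrib wdg_straighten[OF assms(1)]
  using assms(2) by (simp add: beta_coeff_def tens.scale_left_diff_distrib)

text \<open>If \<open>x\<close> annihilates \<open>e\<^sub>s, \<dots>, e\<^bsub>e-1\<^esub>\<close>, then all correction terms in the exchange of \<open>e\<^sub>k\<close>
  and \<open>e\<^sub>r\<close> behind \<open>x\<close> vanish: at least one of the two indices lies in \<open>{s..<e}\<close>.\<close>

lemma wdg_wdg_between_eq_0:
  assumes x: "x \<in> tensor_space N" and zero: "\<And>y. s \<le> y \<Longrightarrow> y < e \<Longrightarrow> wdg N y x = 0"
    and kr: "r \<le> e" "2 * s \<le> k + r" and y: "k < y" "y < r"
  shows "wdg (Suc N) (k + r - y) (wdg N y x) = 0"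
  using y
proof (induction "nat (s - y)" arbitrary: y rule: less_induct)
  case less
  show ?case
  proof (cases "s \<le> y")
    case True
    then show ?thesis using zero[of y] less.prems kr by (simp add: wdg_lin)
  next
    case False
    \<comment> \<open>For y < s the mirror index z lies in the annihilated range. Straightening e_y
      against e_z puts e_z behind x, giving zero, and otherwise leaves inner indices u > y, which
      the induction on the distance below s covers.\<close>
    let ?z = "k + r - y"
    have z: "s \<le> ?z" "?z < e" "y < ?z" using False less.prems kr by simp_all
    have sum: "wdg (Suc N) (k + r - u) (wdg N u x) = 0" if "y < u" "u < ?z" for u
      using less.hyps[of u] that False less.prems by simp
    have "scale (- v) (wdg (Suc N) ?z (wdg N y x)) = 0"
      unfolding wdg_straighten_up[OF x z(3)]
      by (simp add: zero[OF z(1,2)] wdg_lin sum sum.neutral)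
    then show ?thesis using v0 by simp
  qed
qed

lemma wdg_exchange:
  assumes x: "x \<in> tensor_space N" and zero: "\<And>y. s \<le> y \<Longrightarrow> y < e \<Longrightarrow> wdg N y x = 0"
    and kr: "k < r" "r \<le> e" "2 * s \<le> k + r"
  shows "wdg (Suc N) r (wdg N k x) = scale (\<kappa> * alpha_coeff n v k r) (wdg (Suc N) k (wdg N r x))"
proof -
  have "(\<Sum>y\<in>{k<..<r}. scale (gamma_coeff n v k r y) (wdg (Suc N) (k + r - y) (wdg N y x))) = 0"
    using wdg_wdg_between_eq_0[OF x zero kr(2,3)] by (intro sum.neutral) auto
  with wdg_straighten_up[OF x kr(1)]
  have "scale \<kappa> (scale (- v) (wdg (Suc N) r (wdg N k x)))
      = scale \<kappa> (scale (alpha_coeff n v k r) (wdg (Suc N) k (wdg N r x)))" by simp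
  moreover have "\<kappa> * (- v) = 1" using v0 by (simp add: \<kappa>_def)
  ultimately show ?thesis by (simp only: tens.scale_scale tens.scale_one)
qed

text \<open>Exactly one of n consecutive integers is divisible by n.\<close>

lemma prod_dvd_consecutive:
  fixes a :: int
  shows "(\<Prod>h<n. if int n dvd a + int h then v else 1) = v"
proof -
  define h0 where "h0 = nat ((- a) mod int n)"
  have h0: "h0 < n" "int h0 = (- a) mod int n" using n by (auto simp: h0_def nat_less_iff)
  have "int n dvd a + int h \<longleftrightarrow> h = h0" if "h < n" for h
  proof -
    have "int n dvd a + int h \<longleftrightarrow> int h mod int n = (- a) mod int n"
      by (simp add: mod_eq_dvd_iff add.commute)
    also have "int h mod int n = int h" using that by simp
    finally show ?thesis unfolding h0(2)[symmetric] of_nat_eq_iff .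
  qed
  then have "(\<Prod>h<n. if int n dvd a + int h then v else 1) = (\<Prod>h<n. if h = h0 then v else 1)"
    by (intro prod.cong) auto
  then show ?thesis using h0(1) by simp
qed

lemma prod_alpha_coeff:
  assumes "k < e"
  shows "(\<Prod>h<n. \<kappa> * alpha_coeff n v k (e + int h)) = \<kappa> ^ n * v"
proof -
  have "(\<Prod>h<n. alpha_coeff n v k (e + int h)) = (\<Prod>h<n. if int n dvd (e - k) + int h then v else 1)"
    using assms by (intro prod.cong) (auto simp: alpha_coeff_def algebra_simps)
  then show ?thesis using prod_dvd_consecutive[of "e - k"] by (simp add: prod.distrib)
qed

text \<open>Repeated use of \<open>wdg_exchange\<close>. The condition s <= k + j is its requirement
  2 s <= k + r for the first index r = s + j, and later r only grow.\<close>

lemma run_wdg: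
  assumes w: "w \<in> eigenspace N" and k: "k < s + int j" "s \<le> k + int j"
  shows "run (Suc (N + j)) (s + int j) (wdg (N + j) k (run N s w j)) i =
    scale (\<Prod>h<i. \<kappa> * alpha_coeff n v k (s + int j + int h)) (wdg (N + j + i) k (run N s w (j + i)))"
proof (induction i)
  case (Suc i)
  let ?U = "run N s w (j + i)"
  have "wdg (Suc (N + (j + i))) (s + int j + int i) (wdg (N + (j + i)) k ?U) =
     scale (\<kappa> * alpha_coeff n v k (s + int j + int i))
       (wdg (Suc (N + (j + i))) k (wdg (N + (j + i)) (s + int j + int i) ?U))"
    by (rule wdg_exchange[where s = s and e = "s + int (j + i)"])
       (use k run_in_eigenspace[OF w] wdg_run_eq_0[OF w] in auto)
  then show ?case using Suc by (simp add: wdg_lin add.assoc mult.commute)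
qed simp

section \<open>Stabilization of the operators \<Psi>\<close>

lemma floor_shift: "\<lfloor>real_of_int (int (N + n) - 1 - m - k) / real n\<rfloor> =
    \<lfloor>real_of_int (int N - 1 - m - k) / real n\<rfloor> + 1"
proof -
  have "real_of_int (int (N + n) - 1 - m - k) / real n = real_of_int (int N - 1 - m - k) / real n + 1"
    using n by (simp add: field_simps)
  then show ?thesis by simp
qed

lemma Psi_tilde_eq:
  assumes "w \<in> eigenspace N"
  shows "Psi_tilde n v m k N w =
    scale ((- 1) ^ N * v powi (\<lfloor>real_of_int (int N - 1 - m - k) / real n\<rfloor> - int N)) (wdg N k w)"
  by (simp add: Psi_tilde_def Psi_def wedge_e_eq[OF assms])

lemma \<kappa>_pow_times_v: "\<kappa> ^ i * v = (- 1) ^ i * v powi (1 - int i)"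
proof -
  have "\<kappa> ^ i = (- 1) ^ i * inverse v ^ i" unfolding \<kappa>_def by (rule power_minus)
  then show ?thesis using v0 by (simp add: power_int_diff power_inverse field_simps)
qed

lemma stabilizes_Psi_tilde: "stabilizes n v m 1 (Psi_tilde n v m k)"
  unfolding stabilizes_def Wedge_eq
proof (intro conjI allI impI ballI)
  fix N :: nat assume "N \<ge> 1"
  show "Psi_tilde n v m k N \<in> eigenspace N \<rightarrow> eigenspace (nat (int N + 1))"
    by (auto simp: Psi_tilde_eq nat_add_distrib intro!: tens.subspace_scale[OF subspace_eigenspace] wdg_in_eigenspace)
next
  fix l w assume w: "w \<in> eigenspace l"
  define s where "s = int l - m"
  \<comment> \<open>The second entry ensures k < N - m = s + j, and the third ensures s <= k + j, as
    needed for \<open>run_wdg\<close>.\<close>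
  define M where "M = Max {l, nat (k + m), nat (2 * s - k + m)}"
  have "phi n v (m + 1) (nat (int (N + n) + 1)) (nat (int N + 1)) (Psi_tilde n v m k N (phi n v m N l w))
        = Psi_tilde n v m k (N + n) (phi n v m (N + n) l w)" if N: "N > M" for N
  proof -
    define j where "j = N - l"
    have Nj: "N = l + j" and k: "k < s + int j" "s \<le> k + int j"
      using N by (auto simp: M_def j_def s_def)
    let ?U = "run l s w j"
    let ?a = "\<lambda>N. (- 1) ^ N * v powi (\<lfloor>real_of_int (int N - 1 - m - k) / real n\<rfloor> - int N)"
    have U: "phi n v m N l w = ?U" unfolding Nj s_def by (rule phi_eq_run[OF w])
    have UL: "?U \<in> eigenspace N" using run_in_eigenspace[OF w] by (simp add: Nj)
    have U': "phi n v m (N + n) l w = run l s w (j + n)"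
      unfolding Nj s_def add.assoc by (rule phi_eq_run[OF w])
    have UL': "run l s w (j + n) \<in> eigenspace (N + n)" using run_in_eigenspace[OF w, of s "j + n"] by (simp add: Nj add.assoc)
    have "phi n v (m + 1) (Suc N + n) (Suc N) (Psi_tilde n v m k N ?U) =
        scale (?a N) (run (Suc N) (int (Suc N) - (m + 1)) (wdg N k ?U) n)"
      unfolding Psi_tilde_eq[OF UL]
      by (subst phi_eq_run) (use UL in \<open>auto intro!: tens.subspace_scale[OF subspace_eigenspace] wdg_in_eigenspace simp: run_scale\<close>)
    \<comment> \<open>The shift of m by one compensates the extra factor, so the run continues at
      the same index as without \<Psi>.\<close>
    also have "int (Suc N) - (m + 1) = s + int j" by (simp add: s_def Nj)
    also have "run (Suc N) (s + int j) (wdg N k ?U) n = scale (\<kappa> ^ n * v) (wdg (N + n) k (run l s w (j + n)))"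
      unfolding Nj run_wdg[OF w k] prod_alpha_coeff[OF k(1)] ..
    also have "scale (?a N) \<dots> = scale (?a (N + n)) (wdg (N + n) k (run l s w (j + n)))"
    proof -
      have "?a N * (\<kappa> ^ n * v) = ?a (N + n)"
        unfolding \<kappa>_pow_times_v floor_shift using v0 by (simp add: power_add power_int_add[symmetric])
          (simp add: algebra_simps)
      then show ?thesis by simp
    qed
    also have "\<dots> = Psi_tilde n v m k (N + n) (run l s w (j + n))"
      by (rule Psi_tilde_eq[OF UL', symmetric])
    finally show ?thesis unfolding U U' by (simp add: nat_add_distrib)
  qed
  moreover have "M \<ge> l" by (simp add: M_def)
  ultimately show "\<exists>M\<ge>l. \<forall>N>M. phi n v (m + 1) (nat (int (N + n) + 1)) (nat (int N + 1))
      (Psi_tilde n v m k N (phi n v m N l w)) = Psi_tilde n v m k (N + n) (phi n v m (N + n) l w)"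
    by blast
qed


section \<open>Slices of wedge products\<close>

lemma slice_in_eigenspace: "w \<in> eigenspace (Suc N) \<Longrightarrow> slice k w \<in> eigenspace N"
  unfolding eigenspace_def by (auto simp: T_op_slice[OF n v0, symmetric] slice_lin)

lemma slice_foldr_T:
  assumes "w \<in> tensor_space (Suc N)" "\<forall>i\<in>set is. Suc i < N"
  shows "slice k (foldr T is w) = foldr T is (slice k w)"
  using assms(2) by (induction "is") (simp_all add: T_op_slice[OF n v0, where N = N] assms(1))

text \<open>Apply T_N to y (x) e_q (x) e_r and read off the last index p < r. The
  \<open>beta_coeff\<close> term ends in r, the \<open>alpha_coeff\<close> term in q, and an
  intermediate term ends in p only for x = q + r - p, which is in range iff q < p.\<close>

lemma slice_T_app:
  assumes w: "w \<in> tensor_space (Suc N)" and p: "p < r"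
  shows "slice p (T N (app r w)) = scale (alpha_coeff n v p r) (app r (slice p w))
    + (\<Sum>q | q \<in> last_indices w \<and> q < p.
         scale (gamma_coeff n v q r (q + r - p)) (app (q + r - p) (slice q w)))"
proof -
  let ?A = "last_indices w"
  let ?f = "\<lambda>q. scale (gamma_coeff n v q r (q + r - p)) (app (q + r - p) (slice q w))"
  have one: "slice p (T N (app r (app q y))) =
      (if q = p then scale (alpha_coeff n v p r) (app r y) else 0)
      + (if q < p then scale (gamma_coeff n v q r (q + r - p)) (app (q + r - p) y) else 0)"
    if y: "y \<in> tensor_space N" for q y
  proof -
    have s: "slice p (app a (app b y)) = (if p = a then app b y else 0)" for a b
      using y by (simp add: slice_app[of _ "Suc N"])
    have "(\<Sum>x\<in>{min q r<..<max q r}. scale (gamma_coeff n v q r x) (slice p (app (q + r - x) (app x y))))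
       = (\<Sum>x\<in>{min q r<..<max q r}. if x = q + r - p then scale (gamma_coeff n v q r x) (app x y) else 0)"
      by (intro sum.cong refl) (auto simp: s)
    also have "\<dots> = (if q < p then scale (gamma_coeff n v q r (q + r - p)) (app (q + r - p) y) else 0)"
      using p by (auto simp: sum.delta')
    finally show ?thesis using p
      by (simp add: T_op_app_app[OF n v0 y] slice_lin s)
  qed
  have "slice p (T N (app r w)) = slice p (T N (app r (\<Sum>q\<in>?A. app q (slice q w))))"
    using slices_expansion[OF w] by simp
  also have "\<dots> = (\<Sum>q\<in>?A. slice p (T N (app r (app q (slice q w)))))"
    by (simp only: slice_lin app_lin tens2.linear_sum[OF tlin_T_op])
  also have "\<dots> = (\<Sum>q\<in>?A. if q = p then scale (alpha_coeff n v p r) (app r (slice q w)) else 0)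
      + (\<Sum>q\<in>?A. if q < p then ?f q else 0)"
    unfolding sum.distrib[symmetric] by (intro sum.cong refl one) (simp add: w)
  also have "(\<Sum>q\<in>?A. if q = p then scale (alpha_coeff n v p r) (app r (slice q w)) else 0)
      = scale (alpha_coeff n v p r) (app r (slice p w))"
    using slice_eq_0[of p w] by (simp add: app_lin)
  also have "(\<Sum>q\<in>?A. if q < p then ?f q else 0) = (\<Sum>q | q \<in> ?A \<and> q < p. ?f q)"
    by (simp add: sum.If_cases Int_def)
  finally show ?thesis .
qed

text \<open>In the coset expansion the empty word ends in r and drops out. Every other word applies
  T_N first and then generators that commute with slicing; together these form the coset expansion
  with one factor less.\<close>

lemma slice_wdg:
  assumes w: "w \<in> eigenspace (Suc N)" and p: "p < r"
  shows "scale (qint_minus v (Suc (Suc N))) (slice p (wdg (Suc N) r w)) =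
    scale (\<kappa> * qint_minus v (Suc N)) (scale (alpha_coeff n v p r) (wdg N r (slice p w))
    + (\<Sum>q | q \<in> last_indices w \<and> q < p.
         scale (gamma_coeff n v q r (q + r - p)) (wdg N (q + r - p) (slice q w))))"
proof -
  let ?F = "\<lambda>x. \<Sum>i\<le>N. scale (\<kappa> ^ (N - i)) (foldr T [i..<N] x)"
  have ts: "w \<in> tensor_space (Suc N)" using w by simp
  have linF: "tlin ?F" by (intro tlin_sum_fun tlin_scale_fun tlin_foldr_T)
  have F: "?F (app q (slice q' w)) = scale (qint_minus v (Suc N)) (wdg N q (slice q' w))" for q q'
    using wdg_coset_expansion[OF slice_in_eigenspace[OF w]] by simp
  have "scale (qint_minus v (Suc (Suc N))) (slice p (wdg (Suc N) r w))
      = slice p (\<Sum>i\<le>Suc N. scale (\<kappa> ^ (Suc N - i)) (foldr T [i..<Suc N] (app r w)))"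
    by (simp only: wdg_coset_expansion[OF w, symmetric] slice_lin)
  also have "\<dots> = (\<Sum>i\<le>N. scale (\<kappa> ^ (Suc N - i)) (slice p (foldr T [i..<Suc N] (app r w)))) + slice p (app r w)"
    by (simp add: slice_lin)
  also have "slice p (app r w) = 0" using p ts by (simp add: slice_app[of _ "Suc N"])
  also have "(\<Sum>i\<le>N. scale (\<kappa> ^ (Suc N - i)) (slice p (foldr T [i..<Suc N] (app r w))))
      = (\<Sum>i\<le>N. scale \<kappa> (scale (\<kappa> ^ (N - i)) (foldr T [i..<N] (slice p (T N (app r w))))))"
  proof (rule sum.cong[OF refl])
    fix i assume "i \<in> {..N}"
    then have i: "i \<le> N" by simp
    have "slice p (foldr T [i..<N] (T N (app r w))) = foldr T [i..<N] (slice p (T N (app r w)))"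
      by (rule slice_foldr_T[where N = "Suc N"]) (use ts in auto)
    then show "scale (\<kappa> ^ (Suc N - i)) (slice p (foldr T [i..<Suc N] (app r w))) =
        scale \<kappa> (scale (\<kappa> ^ (N - i)) (foldr T [i..<N] (slice p (T N (app r w)))))"
      using i by (simp add: Suc_diff_le)
  qed
  also have "\<dots> = scale \<kappa> (?F (slice p (T N (app r w))))"
    by (simp only: tens.scale_sum_right)
  finally have "scale (qint_minus v (Suc (Suc N))) (slice p (wdg (Suc N) r w)) =
      scale \<kappa> (?F (slice p (T N (app r w))))" by simp
  also have "?F (slice p (T N (app r w))) = scale (alpha_coeff n v p r) (?F (app r (slice p w)))
    + (\<Sum>q | q \<in> last_indices w \<and> q < p.
         scale (gamma_coeff n v q r (q + r - p)) (?F (app (q + r - p) (slice q w))))"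
    unfolding slice_T_app[OF ts p] tlin_simps[OF linF] tens2.linear_sum[OF linF] ..
  also have "\<dots> = scale (qint_minus v (Suc N)) (scale (alpha_coeff n v p r) (wdg N r (slice p w))
    + (\<Sum>q | q \<in> last_indices w \<and> q < p.
         scale (gamma_coeff n v q r (q + r - p)) (wdg N (q + r - p) (slice q w))))"
    unfolding F by (simp add: tens.scale_right_distrib tens.scale_sum_right mult.commute)
  finally show ?thesis by simp
qed

lemma slice_wdg_simple:
  assumes w: "w \<in> eigenspace (Suc N)" and p: "p < r"
    and zero: "\<And>q. q < p \<Longrightarrow> wdg N (q + r - p) (slice q w) = 0"
  shows "scale (qint_minus v (Suc (Suc N))) (slice p (wdg (Suc N) r w)) =
    scale (\<kappa> * alpha_coeff n v p r) (scale (qint_minus v (Suc N)) (wdg N r (slice p w)))"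
  unfolding slice_wdg[OF w p] by (simp add: zero ac_simps)

lemma slice_wdg_cancel:
  assumes "scale (qint_minus v (Suc (Suc N))) x = scale c (scale (qint_minus v (Suc N)) y)"
  shows "\<exists>d. x = scale d y"
proof -
  have "x = scale (inverse (qint_minus v (Suc (Suc N)))) (scale (qint_minus v (Suc (Suc N))) x)"
    using qint_minus_nonzero[of "Suc (Suc N)"] by simp
  then show ?thesis unfolding assms by (auto simp only: tens.scale_scale)
qed

section \<open>Slices of a tensor wedged with a long run\<close>

context
  fixes N :: nat and s k P0 :: int and w :: tens
  assumes w: "w \<in> eigenspace (Suc N)" and ks: "k < s" and P0: "\<And>p. p < P0 \<Longrightarrow> slice p w = 0"
begin

lemma w_run_in_eigenspace: "run (Suc N) s w j \<in> eigenspace (Suc (N + j))"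
  using run_in_eigenspace[OF w] by simp

text \<open>By \<open>slice_wdg\<close> the slice at p after a wedge involves only slices at indices
  up to p, so the lower bound P0 persists.\<close>

lemma slice_run_below:
  assumes "p < P0" "p \<le> k"
  shows "slice p (run (Suc N) s w j) = 0"
  using assms
proof (induction j arbitrary: p)
  case (Suc j)
  have "scale (qint_minus v (Suc (Suc (N + j)))) (slice p (run (Suc N) s w (Suc j))) =
    scale (\<kappa> * alpha_coeff n v p (s + int j)) (scale (qint_minus v (Suc (N + j)))
      (wdg (N + j) (s + int j) (slice p (run (Suc N) s w j))))"
    unfolding run.simps add_Suc
    by (rule slice_wdg_simple[OF w_run_in_eigenspace]) (use Suc ks in \<open>simp_all add: wdg_lin\<close>)
  then show ?case using Suc qint_minus_nonzero[of "Suc (Suc (N + j))"] by (simp add: wdg_lin)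
qed (simp add: P0)

text \<open>The range \<open>d \<le> k - P0\<close> bounds the index shifts that occur in \<open>slice_wdg\<close> for \<open>p \<le> k\<close>.\<close>

definition vanishing :: "int \<Rightarrow> nat \<Rightarrow> bool" where
  "vanishing p J \<longleftrightarrow> (\<forall>j\<ge>J. \<forall>q<p. \<forall>d. 1 \<le> d \<and> d \<le> k - P0 \<longrightarrow>
     wdg (N + j) (s + int j - d) (slice q (run (Suc N) s w j)) = 0)"

text \<open>The correction terms involve slices at q < p. They vanish for q < P0 by
  \<open>slice_run_below\<close>; otherwise the shift p - q is between 1 and k - P0 and is covered
  by \<open>vanishing\<close>.\<close>

lemma slice_run_step:
  assumes van: "vanishing p J" and p: "p \<le> k" and j: "j \<ge> J"
  shows "scale (qint_minus v (Suc (Suc (N + j)))) (slice p (run (Suc N) s w (Suc j))) =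
    scale (\<kappa> * alpha_coeff n v p (s + int j)) (scale (qint_minus v (Suc (N + j)))
      (wdg (N + j) (s + int j) (slice p (run (Suc N) s w j))))"
  unfolding run.simps add_Suc
proof (rule slice_wdg_simple[OF w_run_in_eigenspace])
  show "p < s + int j" using p ks by simp
  fix q assume q: "q < p"
  show "wdg (N + j) (q + (s + int j) - p) (slice q (run (Suc N) s w j)) = 0"
  proof (cases "q < P0")
    case True
    then show ?thesis using slice_run_below[of q j] p q by (simp add: wdg_lin)
  next
    case False
    have "wdg (N + j) (s + int j - (p - q)) (slice q (run (Suc N) s w j)) = 0"
      using van j q p False unfolding vanishing_def by auto
    then show ?thesis by (simp add: algebra_simps)
  qed
qed

text \<open>The scalar is irrelevant here: being a multiple of a run suffices for applying
  \<open>wdg_run_eq_0\<close> to the slice.\<close>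

lemma slice_run_multiple:
  assumes "vanishing p J" "p \<le> k"
  shows "\<exists>c. slice p (run (Suc N) s w (J + i)) =
    scale c (run (N + J) (s + int J) (slice p (run (Suc N) s w J)) i)"
proof (induction i)
  case 0
  show ?case by (intro exI[of _ 1]) simp
next
  case (Suc i)
  then obtain c where c: "slice p (run (Suc N) s w (J + i)) =
    scale c (run (N + J) (s + int J) (slice p (run (Suc N) s w J)) i)" ..
  from slice_wdg_cancel[OF slice_run_step[OF assms, of "J + i"]] obtain d where
    "slice p (run (Suc N) s w (Suc (J + i))) =
      scale d (wdg (N + (J + i)) (s + int (J + i)) (slice p (run (Suc N) s w (J + i))))" by auto
  then have "slice p (run (Suc N) s w (J + Suc i)) =
      scale (d * c) (run (N + J) (s + int J) (slice p (run (Suc N) s w J)) (Suc i))"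
    by (simp add: c wdg_lin add.assoc)
  then show ?case ..
qed

text \<open>After k - P0 further wedges the run behind the slice at p contains all indices s + j - d
  with 1 <= d <= k - P0, so wedging with them again gives zero.\<close>

lemma vanishing_Suc:
  assumes van: "vanishing p J" and p: "p \<le> k"
  shows "vanishing (p + 1) (J + nat (k - P0))"
  unfolding vanishing_def
proof (intro allI impI)
  fix j q d assume j: "j \<ge> J + nat (k - P0)" and q: "q < p + 1" and d: "1 \<le> d \<and> d \<le> k - P0"
  show "wdg (N + j) (s + int j - d) (slice q (run (Suc N) s w j)) = 0"
  proof (cases "q < p")
    case True
    then show ?thesis using van j d unfolding vanishing_def by auto
  next
    case False
    then have qp: "q = p" using q by simp
    define i where "i = j - J"
    have ji: "j = J + i" and di: "d \<le> int i" using j d by (auto simp: i_def)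
    obtain c where c: "slice p (run (Suc N) s w j) =
        scale c (run (N + J) (s + int J) (slice p (run (Suc N) s w J)) i)"
      using slice_run_multiple[OF van p, of i] unfolding ji by blast
    have "wdg (N + J + i) (s + int j - d) (run (N + J) (s + int J) (slice p (run (Suc N) s w J)) i) = 0"
      by (rule wdg_run_eq_0) (use di d in \<open>auto simp: ji intro: slice_in_eigenspace w_run_in_eigenspace\<close>)
    then show ?thesis unfolding qp c by (simp add: wdg_lin ji add.assoc)
  qed
qed

lemma vanishing_exists: "\<exists>J. vanishing k J"
proof -
  have "p \<le> k \<longrightarrow> (\<exists>J. vanishing p J)" if "p \<ge> min P0 k" for p
    using that
  proof (induction p rule: int_ge_induct)
    case base
    have "slice q (run (Suc N) s w j) = 0" if "q < min P0 k" for q j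
      using slice_run_below[of q j] that by simp
    then have "vanishing (min P0 k) 0" unfolding vanishing_def by (simp add: wdg_lin)
    then show ?case by blast
  next
    case (step p)
    then show ?case using vanishing_Suc by fastforce
  qed
  from this[of k] show ?thesis by simp
qed

text \<open>Carrying the quantum integer along with the slice makes these factors telescope, so each
  step contributes only \<kappa> times \<open>alpha_coeff\<close>.\<close>

lemma slice_run_many:
  assumes "vanishing k J" "j \<ge> J"
  shows "scale (qint_minus v (Suc (N + j + i))) (slice k (run (Suc N) s w (j + i))) =
    scale (\<Prod>h<i. \<kappa> * alpha_coeff n v k (s + int j + int h))
      (scale (qint_minus v (Suc (N + j))) (run (N + j) (s + int j) (slice k (run (Suc N) s w j)) i))"
proof (induction i)
  case (Suc i)
  let ?X = "run (N + j) (s + int j) (slice k (run (Suc N) s w j)) i"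
  let ?c = "\<Prod>h<i. \<kappa> * alpha_coeff n v k (s + int j + int h)"
  have "scale (qint_minus v (Suc (N + j + Suc i))) (slice k (run (Suc N) s w (j + Suc i))) =
    scale (\<kappa> * alpha_coeff n v k (s + int j + int i)) (wdg (N + (j + i)) (s + int j + int i)
      (scale (qint_minus v (Suc (N + j + i))) (slice k (run (Suc N) s w (j + i)))))"
    using slice_run_step[OF assms(1) order_refl, of "j + i"] assms(2) by (simp add: wdg_lin add.assoc)
  also have "\<dots> = scale (\<kappa> * alpha_coeff n v k (s + int j + int i)) (wdg (N + (j + i)) (s + int j + int i)
      (scale ?c (scale (qint_minus v (Suc (N + j))) ?X)))"
    unfolding Suc ..
  finally show ?case by (simp add: wdg_lin add.assoc ac_simps)
qed simp

end

section \<open>Stabilization of the operators \<Psi>*\<close>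

lemma floor_shift': "\<lfloor>real_of_int (int (N + n) - 1 - m + k) / real n\<rfloor> =
    \<lfloor>real_of_int (int N - 1 - m + k) / real n\<rfloor> + 1"
  using floor_shift[of N m "- k"] by simp

lemma Psi_star_eq_slice: "Psi_star k w = slice (- k) w"
  by (simp add: Psi_star_def slice_def)

lemma stabilizes_Psi_star_tilde: "stabilizes n v m (- 1) (Psi_star_tilde n v m k)"
  unfolding stabilizes_def Wedge_eq
proof (intro conjI allI impI ballI)
  fix N :: nat assume "N \<ge> 1"
  then obtain N' where N': "N = Suc N'" by (cases N) auto
  show "Psi_star_tilde n v m k N \<in> eigenspace N \<rightarrow> eigenspace (nat (int N + - 1))"
    by (auto simp: Psi_star_tilde_def Psi_star_eq_slice N' intro!: tens.subspace_scale[OF subspace_eigenspace] slice_in_eigenspace)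
next
  fix l w assume w: "w \<in> eigenspace l"
  \<comment> \<open>First wedge up to degree N0 + 1, chosen so that the next index s of the run
    exceeds the slice index -k.\<close>
  define N0 where "N0 = Max {l, nat (m - k)}"
  define s where "s = int (Suc N0) - m"
  define j0 where "j0 = Suc N0 - l"
  have l0: "Suc N0 = l + j0" by (simp add: N0_def j0_def)
  have ks: "- k < s" by (simp add: s_def N0_def)
  define w' where "w' = run l (int l - m) w j0"
  have w': "w' \<in> eigenspace (Suc N0)" unfolding w'_def l0 by (rule run_in_eigenspace[OF w])
  \<comment> \<open>Only finitely many last indices occur; their minimum is the bound, and any value
    does if there are none.\<close>
  obtain P0 where P0: "\<And>p. p < P0 \<Longrightarrow> slice p w' = 0"
  proof (cases "last_indices w' = {}")
    case True
    then show ?thesis using that[of 0] slice_eq_0[of _ w'] by simp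
  next
    case False
    have "p \<notin> last_indices w'" if "p < Min (last_indices w')" for p
      using Min_le[OF finite_last_indices] that by (meson leD)
    then show ?thesis using that[of "Min (last_indices w')"] slice_eq_0 by blast
  qed
  obtain J where J: "vanishing N0 s (- k) P0 w' (- k) J" using vanishing_exists[OF w' ks P0] by blast
  define M where "M = Suc N0 + J"
  have phi: "phi n v m (Suc (N0 + j)) l w = run (Suc N0) s w' j" for j
  proof -
    have e: "Suc (N0 + j) = l + (j0 + j)" using l0 by simp
    have "phi n v m (Suc (N0 + j)) l w = run l (int l - m) w (j0 + j)"
      unfolding e by (rule phi_eq_run[OF w])
    also have "\<dots> = run (Suc N0) s w' j"
      using l0 by (simp add: run_add w'_def s_def algebra_simps)
    finally show ?thesis .
  qed
  have "phi n v (m + - 1) (nat (int (N + n) + - 1)) (nat (int N + - 1)) (Psi_star_tilde n v m k N (phi n v m N l w))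
        = Psi_star_tilde n v m k (N + n) (phi n v m (N + n) l w)" if N: "N > M" for N
  proof -
    define j where "j = N - Suc N0"
    have Nj: "N = Suc (N0 + j)" and jJ: "j \<ge> J" using N by (auto simp: j_def M_def)
    let ?U = "run (Suc N0) s w' j"
    let ?F = "\<lfloor>real_of_int (int N - 1 - m + k) / real n\<rfloor>"
    let ?a = "(- 1) ^ (N0 + j) * v powi (int N - 1 - ?F)"
    have UL: "slice (- k) ?U \<in> eigenspace (N0 + j)"
      by (rule slice_in_eigenspace) (use run_in_eigenspace[OF w', of s j] in simp)
    have U: "phi n v m N l w = ?U" unfolding Nj by (rule phi)
    have U': "phi n v m (N + n) l w = run (Suc N0) s w' (j + n)"
      using phi[of "j + n"] by (simp add: Nj add.assoc)
    have PS: "Psi_star_tilde n v m k N ?U = scale ?a (scale (qint_minus v (Suc (N0 + j))) (slice (- k) ?U))"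
      by (simp add: Psi_star_tilde_def Psi_star_eq_slice Nj ac_simps)
    have "phi n v (m - 1) (N0 + j + n) (N0 + j) (Psi_star_tilde n v m k N ?U) =
        run (N0 + j) (int (N0 + j) - (m - 1)) (Psi_star_tilde n v m k N ?U) n"
      by (rule phi_eq_run)
        (use UL in \<open>simp add: Psi_star_tilde_def Psi_star_eq_slice tens.subspace_scale[OF subspace_eigenspace]\<close>)
    also have "int (N0 + j) - (m - 1) = s + int j" by (simp add: s_def)
    also have "run (N0 + j) (s + int j) (Psi_star_tilde n v m k N ?U) n
        = scale ?a (scale (qint_minus v (Suc (N0 + j))) (run (N0 + j) (s + int j) (slice (- k) ?U) n))"
      unfolding PS by (simp only: run_scale)
    finally have lhs: "phi n v (m - 1) (N0 + j + n) (N0 + j) (Psi_star_tilde n v m k N ?U) =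
      scale ?a (scale (qint_minus v (Suc (N0 + j))) (run (N0 + j) (s + int j) (slice (- k) ?U) n))" .
    have "(\<Prod>h<n. \<kappa> * alpha_coeff n v (- k) (s + int j + int h)) = \<kappa> ^ n * v"
      using ks by (intro prod_alpha_coeff) simp
    then have SR: "scale (qint_minus v (Suc (N0 + j + n))) (slice (- k) (run (Suc N0) s w' (j + n))) =
        scale (\<kappa> ^ n * v) (scale (qint_minus v (Suc (N0 + j))) (run (N0 + j) (s + int j) (slice (- k) ?U) n))"
      using slice_run_many[OF w' ks P0 J jJ, of n] by (simp only:)
    have "Psi_star_tilde n v m k (N + n) (run (Suc N0) s w' (j + n)) =
       scale ((- 1) ^ (N0 + j + n) * v powi (int N + int n - 1 - (?F + 1)))
        (scale (qint_minus v (Suc (N0 + j + n))) (slice (- k) (run (Suc N0) s w' (j + n))))"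
      unfolding Psi_star_tilde_def Psi_star_eq_slice floor_shift' by (simp add: Nj ac_simps)
    also have "\<dots> = scale ((- 1) ^ (N0 + j + n) * v powi (int N + int n - 1 - (?F + 1)) * (\<kappa> ^ n * v))
       (scale (qint_minus v (Suc (N0 + j))) (run (N0 + j) (s + int j) (slice (- k) ?U) n))"
      unfolding SR by (simp only: tens.scale_scale mult.assoc)
    also have "(- 1) ^ (N0 + j + n) * v powi (int N + int n - 1 - (?F + 1)) * (\<kappa> ^ n * v) = ?a"
    proof -
      \<comment> \<open>Moving e_(-k) past n vectors contributes v^(1-n), which exactly offsets the
        growth of the exponent by n - 1: N grows by n and the floor by one.\<close>
      have "int N - 1 - ?F = (int N + int n - 1 - (?F + 1)) + (1 - int n)" by linarith
      then have "v powi (int N + int n - 1 - (?F + 1)) * v powi (1 - int n) = v powi (int N - 1 - ?F)"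
        using power_int_add[of v] v0 by metis
      moreover have "(- 1 :: complex) ^ n * (- 1) ^ n = 1" by (simp add: power_mult_distrib[symmetric])
      moreover have "(- 1) ^ (N0 + j + n) * x * ((- 1) ^ n * y) =
          (- 1) ^ (N0 + j) * (((- 1) ^ n * (- 1) ^ n) * (x * y))" for x y :: complex
        by (simp only: power_add ac_simps)
      ultimately show ?thesis unfolding \<kappa>_pow_times_v by (simp only: mult_1)
    qed
    finally show ?thesis using lhs unfolding U U' by (simp add: Nj nat_add_distrib add.assoc)
  qed
  moreover have "M \<ge> l" by (simp add: M_def N0_def)
  ultimately show "\<exists>M\<ge>l. \<forall>N>M. phi n v (m + - 1) (nat (int (N + n) + - 1)) (nat (int N + - 1))
      (Psi_star_tilde n v m k N (phi n v m N l w)) = Psi_star_tilde n v m k (N + n) (phi n v m (N + n) l w)"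
    by blast
qed

end

theorem proposition5p12:
  fixes n :: nat and v :: complex and m k :: int
  assumes "n \<ge> 1"
    and "v \<noteq> 0"
    and "\<forall>r::nat. r > 0 \<longrightarrow> v ^ r \<noteq> 1"
  shows "stabilizes n v m 1 (Psi_tilde n v m k)
       \<and> stabilizes n v m (- 1) (Psi_star_tilde n v m k)"
proof -
  interpret qwedge n v by (rule qwedge.intro) (fact assms)+
  show ?thesis using stabilizes_Psi_tilde stabilizes_Psi_star_tilde by blast
qed

end
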